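(* Let $\Bbbk$ be a field of characteristic $0$ and let $H$ be a cocommutative weak Hopf algebra over $\Bbbk$. Then ${H_{par}^w}$ admits the structure of a unital quantum inverse semigroup (QISG).
   Context: All algebras are associative and unital over $\Bbbk$; Sweedler notation $\Delta(h)=h_1\otimes h_2$. A weak Hopf algebra is $(H,m,u,\Delta,\varepsilon,S)$ with $H$ an algebra, $(H,\Delta,\varepsilon)$ a coalgebra, and for all $g,h,k$: $\Delta(kh)=\Delta(k)\Delta(h)$; $\varepsilon(kh_1)\varepsilon(h_2g)=\varepsilon(khg)=\varepsilon(kh_2)\varepsilon(h_1g)$; $(1\otimes\Delta(1))(\Delta(1)\otimes1)=\Delta^2(1)=(\Delta(1)\otimes1)(1\otimes\Delta(1))$; $h_1S(h_2)=\varepsilon(1_1h)1_2$; $S(h_1)h_2=1_1\varepsilon(h1_2)$; $S(h)=S(h_1)h_2S(h_3)$, where $\Delta(1)=1_1\otimes1_2$. Cocommutative means $h_1\otimes h_2=h_2\otimes h_1$. ${H_{par}^w}=T(H)/I$, where $T(H)$ is the tensor algebra of the vector space $H$ and $I$ is the ideal generated by, for all $h,k\in H$: $1_H-1_{T(H)}$; $h\otimes k_1\otimes S(k_2)-hk_1\otimes S(k_2)$; $h\otimes S(k_1)\otimes k_2-hS(k_1)\otimes k_2$; $h_1\otimes S(h_2)\otimes k-h_1\otimes S(h_2)k$; $S(h_1)\otimes h_2\otimes k-S(h_1)\otimes h_2k$; $h-h_1\otimes S(h_2)\otimes h_3$. A quantum inverse semigroup is a triple $(\mathcal H,\Delta,\mathcal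 S)$ where: $\mathcal H$ is a (not necessarily unital) $\Bbbk$-ring; $\Delta\colon\mathcal H\to\mathcal H\otimes\mathcal H$ is multiplicative and coassociative; $\mathcal S\colon\mathcal H\to\mathcal H$ is $\Bbbk$-linear with $\mathcal S(hk)=\mathcal S(k)\mathcal S(h)$ and $I*\mathcal S*I=I$, $\mathcal S*I*\mathcal S=\mathcal S$ in the convolution algebra $\mathrm{End}_\Bbbk(\mathcal H)$ (i.e. $h_1\mathcal S(h_2)h_3=h$ and $\mathcal S(h_1)h_2\mathcal S(h_3)=\mathcal S(h)$); and for all $h,k$: $h_1\mathcal S(h_2)\mathcal S(k_1)k_2=\mathcal S(k_1)k_2h_1\mathcal S(h_2)$. It is unital if $\mathcal H$ is a unital algebra and $\mathcal S(1)=1$. *)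

theory Defs
  imports Main "HOL.Vector_Spaces" "HOL-Library.Poly_Mapping"
begin

text \<open>Vector spaces over the field 'k are handled through free vector spaces
  (finitely supported functions on a basis x, valued in the field) and quotients of them by
  subspaces; tensor products of free spaces are free on the product of the bases.\<close>

definition bas :: "'x \<Rightarrow> ('x \<Rightarrow>\<^sub>0 'k::field)" where
  "bas x = Poly_Mapping.single x 1"

definition smult :: "'k::field \<Rightarrow> ('x \<Rightarrow>\<^sub>0 'k) \<Rightarrow> ('x \<Rightarrow>\<^sub>0 'k)" where
  "smult c p = Poly_Mapping.map (\<lambda>a. c * a) p"

definition fext :: "('x \<Rightarrow> ('y \<Rightarrow>\<^sub>0 'k::field)) \<Rightarrow> ('x \<Rightarrow>\<^sub>0 'k) \<Rightarrow> ('y \<Rightarrow>\<^sub>0 'k)" where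
  "fext f p = (\<Sum>x\<in>Poly_Mapping.keys p. smult (Poly_Mapping.lookup p x) (f x))"

definition hext :: "('k::field \<Rightarrow> 'h \<Rightarrow> 'h::ab_group_add) \<Rightarrow> ('x \<Rightarrow> 'h) \<Rightarrow> ('x \<Rightarrow>\<^sub>0 'k) \<Rightarrow> 'h" where
  "hext scale f p = (\<Sum>x\<in>Poly_Mapping.keys p. scale (Poly_Mapping.lookup p x) (f x))"

definition kext :: "('x \<Rightarrow> 'k::field) \<Rightarrow> ('x \<Rightarrow>\<^sub>0 'k) \<Rightarrow> 'k" where
  "kext f p = (\<Sum>x\<in>Poly_Mapping.keys p. Poly_Mapping.lookup p x * f x)"

inductive_set lspan :: "('x \<Rightarrow>\<^sub>0 'k::field) set \<Rightarrow> ('x \<Rightarrow>\<^sub>0 'k) set" for G where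
  lspan_zero: "0 \<in> lspan G"
| lspan_gen: "g \<in> G \<Longrightarrow> g \<in> lspan G"
| lspan_add: "a \<in> lspan G \<Longrightarrow> b \<in> lspan G \<Longrightarrow> a + b \<in> lspan G"
| lspan_smult: "a \<in> lspan G \<Longrightarrow> smult c a \<in> lspan G"

definition otimes :: "('x \<Rightarrow>\<^sub>0 'k::field) \<Rightarrow> ('y \<Rightarrow>\<^sub>0 'k) \<Rightarrow> ('x \<times> 'y \<Rightarrow>\<^sub>0 'k)" where
  "otimes p q = fext (\<lambda>x. fext (\<lambda>y. bas (x, y)) q) p"

text \<open>Elements of the tensor algebra T(H) are represented by formal combinations of
  words over H, modulo the multilinearity relations in each letter.
  The n-th tensor power is the part spanned by words of length n.\<close>

definition mlin_gens :: "('k::field \<Rightarrow> 'h \<Rightarrow> 'h::ab_group_add) \<Rightarrow> ('h list \<Rightarrow>\<^sub>0 'k) set" where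
  "mlin_gens scale =
     {bas (u @ [a + b] @ v) - bas (u @ [a] @ v) - bas (u @ [b] @ v) | u a b v. True}
   \<union> {bas (u @ [scale c a] @ v) - smult c (bas (u @ [a] @ v)) | u c a v. True}"

definition MLrel :: "('k::field \<Rightarrow> 'h \<Rightarrow> 'h::ab_group_add) \<Rightarrow> ('h list \<Rightarrow>\<^sub>0 'k) set" where
  "MLrel scale = lspan (mlin_gens scale)"

text \<open>equality in H\<otimes>H and H\<otimes>H\<otimes>H of formal representatives\<close>
definition T2 :: "('h \<times> 'h \<Rightarrow>\<^sub>0 'k::field) \<Rightarrow> ('h list \<Rightarrow>\<^sub>0 'k)" where
  "T2 p = fext (\<lambda>(a, b). bas [a, b]) p"

definition T3 :: "('h \<times> 'h \<times> 'h \<Rightarrow>\<^sub>0 'k::field) \<Rightarrow> ('h list \<Rightarrow>\<^sub>0 'k)" where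
  "T3 p = fext (\<lambda>(a, b, c). bas [a, b, c]) p"

definition teq2 :: "('k::field \<Rightarrow> 'h \<Rightarrow> 'h::ab_group_add) \<Rightarrow> ('h \<times> 'h \<Rightarrow>\<^sub>0 'k) \<Rightarrow> ('h \<times> 'h \<Rightarrow>\<^sub>0 'k) \<Rightarrow> bool" where
  "teq2 scale p q \<longleftrightarrow> T2 p - T2 q \<in> MLrel scale"

definition teq3 :: "('k::field \<Rightarrow> 'h \<Rightarrow> 'h::ab_group_add) \<Rightarrow> ('h \<times> 'h \<times> 'h \<Rightarrow>\<^sub>0 'k) \<Rightarrow> ('h \<times> 'h \<times> 'h \<Rightarrow>\<^sub>0 'k) \<Rightarrow> bool" where
  "teq3 scale p q \<longleftrightarrow> T3 p - T3 q \<in> MLrel scale"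

definition tmul :: "('w list \<Rightarrow>\<^sub>0 'k::field) \<Rightarrow> ('w list \<Rightarrow>\<^sub>0 'k) \<Rightarrow> ('w list \<Rightarrow>\<^sub>0 'k)" where
  "tmul p q = fext (\<lambda>x. fext (\<lambda>y. bas (x @ y)) q) p"

text \<open>H is the type 'h (a ring with 1, i.e. multiplication and unit of H), with
  scalar multiplication scale making it a 'k-algebra; comultiplication Delta is given
  by a representative in the free space on H\<times>H (i.e. an element of H\<otimes>H);
  Sweedler notation h1\<otimes>h2 is the sum over this representative.\<close>

definition Delta2 :: "('h \<Rightarrow> ('h \<times> 'h \<Rightarrow>\<^sub>0 'k::field)) \<Rightarrow> 'h \<Rightarrow> ('h \<times> 'h \<times> 'h \<Rightarrow>\<^sub>0 'k)" where
  "Delta2 Delta h = fext (\<lambda>(a, b). fext (\<lambda>(b1, b2). bas (a, b1, b2)) (Delta b)) (Delta h)"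

definition Delta2' :: "('h \<Rightarrow> ('h \<times> 'h \<Rightarrow>\<^sub>0 'k::field)) \<Rightarrow> 'h \<Rightarrow> ('h \<times> 'h \<times> 'h \<Rightarrow>\<^sub>0 'k)" where
  "Delta2' Delta h = fext (\<lambda>(a, b). fext (\<lambda>(a1, a2). bas (a1, a2, b)) (Delta a)) (Delta h)"

definition weak_hopf_algebra ::
  "('k::field \<Rightarrow> 'h::ring_1 \<Rightarrow> 'h) \<Rightarrow> ('h \<Rightarrow> ('h \<times> 'h \<Rightarrow>\<^sub>0 'k)) \<Rightarrow> ('h \<Rightarrow> 'k) \<Rightarrow> ('h \<Rightarrow> 'h) \<Rightarrow> bool" where
  "weak_hopf_algebra scale Delta eps S \<longleftrightarrow>
     \<comment> \<open>H is an associative unital 'k-algebra\<close>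
     vector_space scale
   \<and> (\<forall>c x y. scale c (x * y) = scale c x * y \<and> scale c (x * y) = x * scale c y)
     \<comment> \<open>Delta, eps, S are 'k-linear\<close>
   \<and> (\<forall>x y. teq2 scale (Delta (x + y)) (Delta x + Delta y))
   \<and> (\<forall>c x. teq2 scale (Delta (scale c x)) (smult c (Delta x)))
   \<and> (\<forall>x y. eps (x + y) = eps x + eps y) \<and> (\<forall>c x. eps (scale c x) = c * eps x)
   \<and> (\<forall>x y. S (x + y) = S x + S y) \<and> (\<forall>c x. S (scale c x) = scale c (S x))
     \<comment> \<open>(H, Delta, eps) is a coalgebra\<close>
   \<and> (\<forall>h. teq3 scale (Delta2' Delta h) (Delta2 Delta h))
   \<and> (\<forall>h. hext scale (\<lambda>(a, b). scale (eps a) b) (Delta h) = h)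
   \<and> (\<forall>h. hext scale (\<lambda>(a, b). scale (eps b) a) (Delta h) = h)
     \<comment> \<open>Delta(kh) = Delta(k) Delta(h)\<close>
   \<and> (\<forall>k h. teq2 scale (Delta (k * h))
        (fext (\<lambda>(a, b). fext (\<lambda>(a', b'). bas (a * a', b * b')) (Delta h)) (Delta k)))
     \<comment> \<open>eps(k h1) eps(h2 g) = eps(k h g) = eps(k h2) eps(h1 g)\<close>
   \<and> (\<forall>k h g. kext (\<lambda>(a, b). eps (k * a) * eps (b * g)) (Delta h) = eps (k * h * g)
           \<and> eps (k * h * g) = kext (\<lambda>(a, b). eps (k * b) * eps (a * g)) (Delta h))
     \<comment> \<open>(1 \<otimes> Delta(1))(Delta(1) \<otimes> 1) = Delta^2(1) = (Delta(1) \<otimes> 1)(1 \<otimes> Delta(1))\<close>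
   \<and> teq3 scale (fext (\<lambda>(a, b). fext (\<lambda>(a', b'). bas (a', a * b', b)) (Delta 1)) (Delta 1))
                (Delta2 Delta 1)
   \<and> teq3 scale (Delta2 Delta 1)
                (fext (\<lambda>(a, b). fext (\<lambda>(a', b'). bas (a', b' * a, b)) (Delta 1)) (Delta 1))
     \<comment> \<open>h1 S(h2) = eps(1_1 h) 1_2\<close>
   \<and> (\<forall>h. hext scale (\<lambda>(a, b). a * S b) (Delta h) = hext scale (\<lambda>(a, b). scale (eps (a * h)) b) (Delta 1))
     \<comment> \<open>S(h1) h2 = 1_1 eps(h 1_2)\<close>
   \<and> (\<forall>h. hext scale (\<lambda>(a, b). S a * b) (Delta h) = hext scale (\<lambda>(a, b). scale (eps (h * b)) a) (Delta 1))
     \<comment> \<open>S(h) = S(h1) h2 S(h3)\<close>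
   \<and> (\<forall>h. S h = hext scale (\<lambda>(a, b, c). S a * b * S c) (Delta2 Delta h))"

definition cocommutative ::
  "('k::field \<Rightarrow> 'h::ab_group_add \<Rightarrow> 'h) \<Rightarrow> ('h \<Rightarrow> ('h \<times> 'h \<Rightarrow>\<^sub>0 'k)) \<Rightarrow> bool" where
  "cocommutative scale Delta \<longleftrightarrow>
     (\<forall>h. teq2 scale (Delta h) (fext (\<lambda>(a, b). bas (b, a)) (Delta h)))"

definition sw :: "('h \<Rightarrow> ('h \<times> 'h \<Rightarrow>\<^sub>0 'k::field)) \<Rightarrow> 'h \<Rightarrow> ('h \<Rightarrow> 'h \<Rightarrow> ('y \<Rightarrow>\<^sub>0 'k)) \<Rightarrow> ('y \<Rightarrow>\<^sub>0 'k)" where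
  "sw Delta h f = fext (\<lambda>(a, b). f a b) (Delta h)"

definition par_gens ::
  "('h::ring_1 \<Rightarrow> ('h \<times> 'h \<Rightarrow>\<^sub>0 'k::field)) \<Rightarrow> ('h \<Rightarrow> 'h) \<Rightarrow> ('h list \<Rightarrow>\<^sub>0 'k) set" where
  "par_gens Delta S =
     {bas [1] - bas []}
   \<union> {sw Delta k (\<lambda>a b. bas [h, a, S b] - bas [h * a, S b]) | h k. True}
   \<union> {sw Delta k (\<lambda>a b. bas [h, S a, b] - bas [h * S a, b]) | h k. True}
   \<union> {sw Delta h (\<lambda>a b. bas [a, S b, k] - bas [a, S b * k]) | h k. True}
   \<union> {sw Delta h (\<lambda>a b. bas [S a, b, k] - bas [S a, b * k]) | h k. True}
   \<union> {bas [h] - sw Delta h (\<lambda>a b. sw Delta b (\<lambda>b1 b2. bas [a, S b1, b2])) | h. True}"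

text \<open>The kernel of T(H)-formal-combinations \<rightarrow> H_par^w: the multilinearity relations
  (giving T(H)) plus the two-sided ideal generated by par_gens.\<close>
definition Hpar_rel ::
  "('k::field \<Rightarrow> 'h::ring_1 \<Rightarrow> 'h) \<Rightarrow> ('h \<Rightarrow> ('h \<times> 'h \<Rightarrow>\<^sub>0 'k)) \<Rightarrow> ('h \<Rightarrow> 'h) \<Rightarrow> ('h list \<Rightarrow>\<^sub>0 'k) set" where
  "Hpar_rel scale Delta S =
     lspan (mlin_gens scale \<union> {tmul (bas u) (tmul g (bas v)) | u g v. g \<in> par_gens Delta S})"

text \<open>A is presented as F(X)/J with multiplication mul (on representatives) and unit one;
  A\<otimes>A = F(X\<times>X)/(J\<otimes>F + F\<otimes>J), A\<otimes>A\<otimes>A similarly. The comultiplication and antipode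
  are given on representatives and required to be well defined.\<close>

definition J2 :: "('x \<Rightarrow>\<^sub>0 'k::field) set \<Rightarrow> ('x \<times> 'x \<Rightarrow>\<^sub>0 'k) set" where
  "J2 J = lspan ({otimes j (bas y) | j y. j \<in> J} \<union> {otimes (bas y) j | j y. j \<in> J})"

definition J3 :: "('x \<Rightarrow>\<^sub>0 'k::field) set \<Rightarrow> ('x \<times> 'x \<times> 'x \<Rightarrow>\<^sub>0 'k) set" where
  "J3 J = lspan ({otimes j (bas (y, z)) | j y z. j \<in> J}
              \<union> {otimes (bas y) (otimes j (bas z)) | j y z. j \<in> J}
              \<union> {otimes (bas y) (otimes (bas z) j) | j y z. j \<in> J})"

definition unital_qisg_on ::
  "(('x \<Rightarrow>\<^sub>0 'k::field) \<Rightarrow> ('x \<Rightarrow>\<^sub>0 'k) \<Rightarrow> ('x \<Rightarrow>\<^sub>0 'k)) \<Rightarrow> ('x \<Rightarrow>\<^sub>0 'k) \<Rightarrow> ('x \<Rightarrow>\<^sub>0 'k) set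
   \<Rightarrow> (('x \<Rightarrow>\<^sub>0 'k) \<Rightarrow> ('x \<times> 'x \<Rightarrow>\<^sub>0 'k)) \<Rightarrow> (('x \<Rightarrow>\<^sub>0 'k) \<Rightarrow> ('x \<Rightarrow>\<^sub>0 'k)) \<Rightarrow> bool" where
  "unital_qisg_on mul one J D S \<longleftrightarrow>
     \<comment> \<open>D : A \<rightarrow> A\<otimes>A and S : A \<rightarrow> A are well-defined 'k-linear maps\<close>
     (\<forall>p q. p - q \<in> J \<longrightarrow> D p - D q \<in> J2 J)
   \<and> (\<forall>p q. D (p + q) - (D p + D q) \<in> J2 J)
   \<and> (\<forall>c p. D (smult c p) - smult c (D p) \<in> J2 J)
   \<and> (\<forall>p q. p - q \<in> J \<longrightarrow> S p - S q \<in> J)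
   \<and> (\<forall>p q. S (p + q) - (S p + S q) \<in> J)
   \<and> (\<forall>c p. S (smult c p) - smult c (S p) \<in> J)
     \<comment> \<open>D multiplicative\<close>
   \<and> (\<forall>p q. D (mul p q) -
        fext (\<lambda>(x, y). fext (\<lambda>(x', y'). otimes (mul (bas x) (bas x')) (mul (bas y) (bas y'))) (D q)) (D p)
        \<in> J2 J)
     \<comment> \<open>D coassociative\<close>
   \<and> (\<forall>p. fext (\<lambda>(x, y). fext (\<lambda>(x1, x2). bas (x1, x2, y)) (D (bas x))) (D p)
        - fext (\<lambda>(x, y). fext (\<lambda>(y1, y2). bas (x, y1, y2)) (D (bas y))) (D p) \<in> J3 J)
     \<comment> \<open>S anti-multiplicative\<close>
   \<and> (\<forall>p q. S (mul p q) - mul (S q) (S p) \<in> J)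
     \<comment> \<open>I * S * I = I\<close>
   \<and> (\<forall>p. fext (\<lambda>(x, y). fext (\<lambda>(y1, y2). mul (mul (bas x) (S (bas y1))) (bas y2)) (D (bas y))) (D p)
        - p \<in> J)
     \<comment> \<open>S * I * S = S\<close>
   \<and> (\<forall>p. fext (\<lambda>(x, y). fext (\<lambda>(y1, y2). mul (mul (S (bas x)) (bas y1)) (S (bas y2))) (D (bas y))) (D p)
        - S p \<in> J)
     \<comment> \<open>h1 S(h2) S(k1) k2 = S(k1) k2 h1 S(h2)\<close>
   \<and> (\<forall>p q. fext (\<lambda>(x, y). fext (\<lambda>(x', y').
              mul (mul (mul (bas x) (S (bas y))) (S (bas x'))) (bas y')) (D q)) (D p)
         - fext (\<lambda>(x, y). fext (\<lambda>(x', y').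
              mul (mul (mul (S (bas x')) (bas y')) (bas x)) (S (bas y))) (D q)) (D p) \<in> J)
     \<comment> \<open>unital: S(1) = 1\<close>
   \<and> S one - one \<in> J"

end

theory Submission
  imports Defs
begin

text \<open>
  The comultiplication and antipode of \<open>H\<^sub>p\<^sub>a\<^sub>r\<close> are induced by \<open>[h] \<mapsto> [h\<^sub>1] \<otimes> [h\<^sub>2]\<close> and \<open>[h] \<mapsto> [S h]\<close>.
  They respect the defining relations because, in a cocommutative weak Hopf algebra, \<open>S\<close> is an
  anti-homomorphism of algebras and a homomorphism of coalgebras. The regularity axioms
  reduce to letters once the elements \<open>w\<^sub>1 S(w\<^sub>2)\<close> and \<open>S(v\<^sub>1) v\<^sub>2\<close> are known to commute, which follows by
  induction on the length of words.

  An element of a vector space presented by generators and relations is zero iff every linear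
  functional killing the relations kills it. This turns every identity in \<open>H\<close>, \<open>H \<otimes> H\<close>, \<open>H\<^sub>p\<^sub>a\<^sub>r\<close> or its
  tensor powers into an identity between scalar-valued Sweedler sums of multilinear forms.
\<close>

section \<open>Linear functionals on free vector spaces\<close>

text \<open>The model is the partial group algebra, where [g][h] is not [gh] but [g][g^{-1}][gh],
  and the idempotents [g][g^{-1}] commute. Two obstacles separate the weak case from it. One is that
  \<Delta>(1) need not be 1 \<otimes> 1: an element h_1 S(h_2) or S(h_1) h_2 that is moved turns
  into a leg of \<Delta>(1), which a neighbouring letter has to absorb. This is done by h_1
  \<otimes> h_2 S(h_3) = 1_1 h \<otimes> 1_2, by S(h_1) h_2 \<otimes> h_3 = 1_1 \<otimes> h 1_2 and
  by 1_1 \<otimes> S(1_2) = \<Delta>(1). The other is that the comultiplication sends the letters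
  k_1, S(k_2) of a relation to k_1, S(k_3) in one tensor leg and k_2, S(k_4) in the other; only
  after k_2 and k_3 are exchanged is this the same relation in each leg, and cocommutativity allows
  the exchange. The commutation of w_1 S(w_2) with S(v_1) v_2 rests on the case of a single letter v
  = k, where [S k_1][k_2] is pushed through w one letter at a time while k changes.\<close>

lemma lookup_smult: "Poly_Mapping.lookup (smult c p) x = c * Poly_Mapping.lookup p x"
  unfolding smult_def by (simp add: Poly_Mapping.map.rep_eq when_def)

interpretation free: vector_space "smult :: 'k::field \<Rightarrow> ('x \<Rightarrow>\<^sub>0 'k) \<Rightarrow> _"
  by unfold_locales
    (auto intro!: poly_mapping_eqI simp: lookup_smult lookup_add algebra_simps)

lemma kext_superset:
  assumes "finite A" "Poly_Mapping.keys p \<subseteq> A"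
  shows "kext f p = (\<Sum>x\<in>A. Poly_Mapping.lookup p x * f x)"
  unfolding kext_def
  by (rule sum.mono_neutral_left) (use assms in \<open>auto simp: in_keys_iff\<close>)

lemma kext_add: "kext f (p + q) = kext f p + kext f q"
proof -
  let ?A = "Poly_Mapping.keys p \<union> Poly_Mapping.keys q"
  have "Poly_Mapping.keys (p + q) \<subseteq> ?A" by (rule keys_add)
  then show ?thesis
    by (simp add: kext_superset[of ?A] lookup_add algebra_simps sum.distrib)
qed

lemma kext_smult: "kext f (smult c p) = c * kext f p"
proof -
  have "Poly_Mapping.keys (smult c p) \<subseteq> Poly_Mapping.keys p"
    by (auto simp: in_keys_iff lookup_smult)
  then show ?thesis
    by (simp add: kext_superset[of "Poly_Mapping.keys p"] lookup_smult algebra_simps sum_distrib_left)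
qed

lemma kext_zero: "kext f 0 = 0"
  by (simp add: kext_def)

lemma kext_diff: "kext f (p - q) = kext f p - kext f q"
  using kext_add[of f "p - q" q] by simp

lemma kext_sum: "kext f (sum g A) = (\<Sum>x\<in>A. kext f (g x))"
  by (induction A rule: infinite_finite_induct) (auto simp: kext_add kext_zero)

lemma kext_bas: "kext f (bas x) = f x"
  by (simp add: kext_def bas_def)

text \<open>Functionals pull back along extended maps. Rewriting with this removes every
  \<open>fext\<close> from the axioms and leaves iterated scalar sums.\<close>

lemma kext_fext: "kext f (fext g p) = kext (\<lambda>x. kext f (g x)) p"
  by (simp add: fext_def kext_sum kext_smult) (simp add: kext_def)

lemma kext_case_fext:
  "kext f (fext (\<lambda>(a, b). g a b) p) = kext (\<lambda>(a, b). kext f (g a b)) p"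
  by (simp add: kext_fext case_prod_unfold)

lemma kext_plus_fun: "kext (\<lambda>x. f x + g x) p = kext f p + kext g p"
  by (simp add: kext_def algebra_simps sum.distrib)

lemma kext_minus_fun: "kext (\<lambda>x. f x - g x) p = kext f p - kext g p"
  by (simp add: kext_def algebra_simps sum_subtractf)

lemma kext_times_fun: "kext (\<lambda>x. c * f x) p = c * kext f p"
  by (simp add: kext_def algebra_simps sum_distrib_left)

lemma kext_swap: "kext (\<lambda>x. kext (\<lambda>y. f x y) q) p = kext (\<lambda>y. kext (\<lambda>x. f x y) p) q"
  by (simp add: kext_def sum_distrib_left algebra_simps) (rule sum.swap)

lemma fext_bas: "fext f (bas x) = f x"
  by (simp add: fext_def bas_def free.scale_one)

lemma kext_tmul: "kext f (tmul p q) = kext (\<lambda>x. kext (\<lambda>y. f (x @ y)) q) p"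
  by (simp add: tmul_def kext_fext kext_bas)

lemma tmul_bas: "tmul (bas u) (bas v) = bas (u @ v)"
  by (simp add: tmul_def fext_bas)

lemma kext_otimes: "kext f (otimes p q) = kext (\<lambda>x. kext (\<lambda>y. f (x, y)) q) p"
  by (simp add: otimes_def kext_fext kext_bas)

lemma lspan_eq_span: "lspan G = free.span G"
proof
  show "lspan G \<subseteq> free.span G"
  proof
    fix x assume "x \<in> lspan G"
    then show "x \<in> free.span G"
      by induction (auto intro: free.span_zero free.span_base free.span_add free.span_scale)
  qed
  show "free.span G \<subseteq> lspan G"
    by (rule free.span_minimal)
      (auto intro: lspan.intros simp: free.subspace_def)
qed

lemma kext_lspan:
  assumes "p \<in> lspan G" "\<And>g. g \<in> G \<Longrightarrow> kext f g = 0"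
  shows "kext f p = 0"
  using assms by induction (auto simp: kext_zero kext_add kext_smult)

lemma sum_bas: "p = (\<Sum>x\<in>Poly_Mapping.keys p. smult (Poly_Mapping.lookup p x) (bas x))"
proof (rule poly_mapping_eqI)
  fix y
  show "Poly_Mapping.lookup p y =
    Poly_Mapping.lookup (\<Sum>x\<in>Poly_Mapping.keys p. smult (Poly_Mapping.lookup p x) (bas x)) y"
    by (simp add: lookup_sum lookup_smult bas_def lookup_single when_def if_distrib in_keys_iff cong: if_cong)
qed

text \<open>If \<open>p\<close> lies outside the span, then \<open>p\<close> together with a maximal
  independent subset of \<open>G\<close> is independent, so some linear map is 1 at \<open>p\<close>
  and 0 on \<open>G\<close>. A linear map on a free space is \<open>kext\<close> of its values on
  the basis, so the assumption applies to it.\<close>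

lemma lspanI_functionals:
  fixes p :: "'x \<Rightarrow>\<^sub>0 'k::field"
  assumes "\<And>f. (\<And>g. g \<in> G \<Longrightarrow> kext f g = 0) \<Longrightarrow> kext f p = 0"
  shows "p \<in> lspan G"
proof (rule ccontr)
  assume "p \<notin> lspan G"
  then have p: "p \<notin> free.span G" by (simp add: lspan_eq_span)
  interpret vector_space_pair "smult :: 'k \<Rightarrow> ('x \<Rightarrow>\<^sub>0 'k) \<Rightarrow> _" "(*) :: 'k \<Rightarrow> 'k \<Rightarrow> 'k"
    by unfold_locales (auto simp: algebra_simps)
  obtain B where B: "B \<subseteq> G" "\<not> free.dependent B" "G \<subseteq> free.span B"
    using free.maximal_independent_subset[of G] by blast
  have pB: "p \<notin> free.span B"
    using p B(1) free.span_mono by blast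
  have "\<not> free.dependent (insert p B)"
    using B(2) pB by (simp add: free.independent_insert)
  then obtain L where L: "Vector_Spaces.linear smult (*) L"
    "\<forall>x\<in>insert p B. L x = (if x = p then 1 else 0)"
    using linear_independent_extend[of "insert p B" "\<lambda>x. if x = p then 1 else 0"] by blast
  have kL: "kext (\<lambda>x. L (bas x)) q = L q" for q
    by (subst (2) sum_bas) (simp add: linear_sum[OF L(1)] linear_scale[OF L(1)] kext_def)
  have "L x = 0" if "x \<in> B" for x
    using L(2) that pB free.span_base by fastforce
  then have "L g = 0" if "g \<in> G" for g
    using linear_eq_0_on_span[OF L(1)] B(3) that by blast
  then have "kext (\<lambda>x. L (bas x)) p = 0"
    by (intro assms) (simp add: kL)
  then show False using L(2) by (simp add: kL)
qed

section \<open>Sweedler sums in a cocommutative weak Hopf algebra\<close>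

locale cocommutative_weak_hopf =
  fixes scale :: "'k::field \<Rightarrow> 'h::ring_1 \<Rightarrow> 'h"
    and Delta :: "'h \<Rightarrow> ('h \<times> 'h \<Rightarrow>\<^sub>0 'k)"
    and eps :: "'h \<Rightarrow> 'k"
    and S :: "'h \<Rightarrow> 'h"
  assumes whopf: "weak_hopf_algebra scale Delta eps S"
    and cocomm: "cocommutative scale Delta"
begin

definition lin :: "('h \<Rightarrow> 'k) \<Rightarrow> bool" where
  "lin f \<longleftrightarrow> (\<forall>x y. f (x + y) = f x + f y) \<and> (\<forall>c x. f (scale c x) = c * f x)"

definition linH :: "('h \<Rightarrow> 'h) \<Rightarrow> bool" where
  "linH t \<longleftrightarrow> (\<forall>x y. t (x + y) = t x + t y) \<and> (\<forall>c x. t (scale c x) = scale c (t x))"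

text \<open>These are the functionals on words that factor through T(H), as
  \<open>mlin_iff_kext\<close> confirms.\<close>

definition mlin :: "('h list \<Rightarrow> 'k) \<Rightarrow> bool" where
  "mlin f \<longleftrightarrow> (\<forall>u v. lin (\<lambda>x. f (u @ x # v)))"

text \<open>Typically \<open>t x\<close> is a word with \<open>x\<close> in one letter, possibly
  under a linear map. Stated by duality, the notion is closed under \<open>#\<close>,
  \<open>@\<close> and later \<open>Sw\<close>, so that linearity in a letter can be derived by
  introduction rules.\<close>

definition slot :: "('h \<Rightarrow> 'h list) \<Rightarrow> bool" where
  "slot t \<longleftrightarrow> (\<forall>f. mlin f \<longrightarrow> lin (\<lambda>x. f (t x)))"

text \<open>\<open>swf h f\<close> is the Sweedler sum of \<open>f h\<^sub>1 h\<^sub>2\<close>. It depends only on the class of \<open>Delta h\<close>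
  in \<open>H \<otimes> H\<close> when \<open>f\<close> is bilinear, which explains the linearity side conditions below.\<close>

definition swf :: "'h \<Rightarrow> ('h \<Rightarrow> 'h \<Rightarrow> 'k) \<Rightarrow> 'k" where
  "swf h f = kext (\<lambda>(a, b). f a b) (Delta h)"

lemma scale_mult: "scale c x * y = scale c (x * y)" "x * scale c y = scale c (x * y)"
proof -
  have "\<forall>c x y. scale c (x * y) = scale c x * y \<and> scale c (x * y) = x * scale c y"
    using whopf unfolding weak_hopf_algebra_def by (elim conjE)
  then show "scale c x * y = scale c (x * y)" "x * scale c y = scale c (x * y)"
    by metis+
qed

lemma S_add: "S (x + y) = S x + S y" and S_scale: "S (scale c x) = scale c (S x)"
  and eps_add: "eps (x + y) = eps x + eps y" and eps_scale: "eps (scale c x) = c * eps x"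
proof -
  have "\<forall>x y. S (x + y) = S x + S y" "\<forall>c x. S (scale c x) = scale c (S x)"
    "\<forall>x y. eps (x + y) = eps x + eps y" "\<forall>c x. eps (scale c x) = c * eps x"
    using whopf unfolding weak_hopf_algebra_def by - (elim conjE, assumption)+
  then show "S (x + y) = S x + S y" "S (scale c x) = scale c (S x)"
    "eps (x + y) = eps x + eps y" "eps (scale c x) = c * eps x" by simp_all
qed

lemma linI: "(\<And>x y. f (x + y) = f x + f y) \<Longrightarrow> (\<And>c x. f (scale c x) = c * f x) \<Longrightarrow> lin f"
  by (simp add: lin_def)

lemma mlinI: "(\<And>u v. lin (\<lambda>x. f (u @ x # v))) \<Longrightarrow> mlin f"
  by (simp add: mlin_def)

lemma lin_comp: "lin f \<Longrightarrow> linH t \<Longrightarrow> lin (\<lambda>x. f (t x))"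
  by (simp add: lin_def linH_def)

lemma lin_mlin: "mlin f \<Longrightarrow> slot t \<Longrightarrow> lin (\<lambda>x. f (t x))"
  by (simp add: slot_def)

lemma mlinD: "mlin f \<Longrightarrow> lin (\<lambda>x. f (u @ x # v))"
  by (simp add: mlin_def)

lemma mlin_Cons: "mlin f \<Longrightarrow> mlin (\<lambda>w. f (a # w))"
  using mlinD[of f "a # u" for u] by (simp add: mlin_def)

lemma mlin_append_left: "mlin f \<Longrightarrow> mlin (\<lambda>w. f (u @ w))"
  using mlinD[of f "u @ v" for v] by (simp add: mlin_def)

lemma mlin_append_right: "mlin f \<Longrightarrow> mlin (\<lambda>w. f (w @ v))"
  unfolding mlin_def by simp

lemma slot_head: "linH t \<Longrightarrow> slot (\<lambda>x. t x # v)"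
  unfolding slot_def
proof (intro allI impI)
  fix f assume t: "linH t" and "mlin f"
  then have "lin (\<lambda>x. f ([] @ x # v))" unfolding mlin_def by blast
  from lin_comp[OF this t] show "lin (\<lambda>x. f (t x # v))" by simp
qed

lemma slot_Cons: "slot t \<Longrightarrow> slot (\<lambda>x. a # t x)"
  unfolding slot_def using mlin_Cons by blast

lemma slot_append_left: "slot t \<Longrightarrow> slot (\<lambda>x. u @ t x)"
  unfolding slot_def using mlin_append_left by blast

lemma slot_append_right: "slot t \<Longrightarrow> slot (\<lambda>x. t x @ v)"
  unfolding slot_def using mlin_append_right by blast

lemma linH_id: "linH (\<lambda>x. x)" and linH_S: "linH t \<Longrightarrow> linH (\<lambda>x. S (t x))"
  and linH_mult_left: "linH t \<Longrightarrow> linH (\<lambda>x. a * t x)"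
  and linH_mult_right: "linH t \<Longrightarrow> linH (\<lambda>x. t x * a)"
  by (simp_all add: linH_def S_add S_scale scale_mult distrib_left distrib_right)

lemma lin_eps: "linH t \<Longrightarrow> lin (\<lambda>x. eps (t x))"
  by (simp add: lin_def linH_def eps_add eps_scale)

lemma lin_times_left: "lin f \<Longrightarrow> lin (\<lambda>x. c * f x)"
  and lin_times_right: "lin f \<Longrightarrow> lin (\<lambda>x. f x * c)"
  by (simp_all add: lin_def algebra_simps)

lemma lin_sw_body: "(\<And>a b. lin (\<lambda>x. f x a b)) \<Longrightarrow> lin (\<lambda>x. swf h (\<lambda>a b. f x a b))"
  by (simp add: lin_def swf_def case_prod_unfold kext_plus_fun kext_times_fun)

lemma sw_cong: "(\<And>a b. f a b = g a b) \<Longrightarrow> swf h f = swf h g"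
  by (simp add: swf_def)

lemma sw_swap: "swf h (\<lambda>a b. swf k (\<lambda>c d. f a b c d)) = swf k (\<lambda>c d. swf h (\<lambda>a b. f a b c d))"
  by (simp add: swf_def case_prod_unfold) (rule kext_swap)

lemma sw_times: "swf h (\<lambda>a b. c * f a b) = c * swf h f"
  by (simp add: swf_def case_prod_unfold kext_times_fun)

section \<open>From identities between tensors to identities between Sweedler sums\<close>

lemma kext_mlin_gens:
  assumes "mlin f" "g \<in> mlin_gens scale" shows "kext f g = 0"
  using assms unfolding mlin_gens_def mlin_def lin_def
  by (auto simp: kext_diff kext_smult kext_bas)

text \<open>The form \<open>f\<close> extends to a functional \<open>L\<close> on all words that is
  0 on words of length other than two. \<open>L\<close> is multilinear, hence kills the relations of
  T(H) and sees only classes in H \<otimes> H.\<close>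

lemma teq2D:
  assumes "teq2 scale p q" and f: "\<And>b. lin (\<lambda>a. f a b)" "\<And>a. lin (\<lambda>b. f a b)"
  shows "kext (\<lambda>(a, b). f a b) p = kext (\<lambda>(a, b). f a b) q"
proof -
  define L where "L w = (case w of [a, b] \<Rightarrow> f a b | _ \<Rightarrow> 0)" for w
  have "lin (\<lambda>x. L (u @ x # v))" for u v
  proof (cases "length u + length v = 1")
    case True
    then have "(u = [] \<and> (\<exists>b. v = [b])) \<or> ((\<exists>a. u = [a]) \<and> v = [])"
      by (cases u; cases v) auto
    then show ?thesis using f by (auto simp: L_def)
  next
    case False
    then have "L (u @ x # v) = 0" for x
      by (auto simp: L_def split: list.split) (auto simp: Cons_eq_append_conv append_eq_Cons_conv)
    then show ?thesis by (simp add: lin_def)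
  qed
  then have "mlin L" by (rule mlinI)
  then have "kext L (T2 p - T2 q) = 0"
    using assms(1) unfolding teq2_def MLrel_def by (auto intro: kext_lspan kext_mlin_gens)
  moreover have "kext L (T2 r) = kext (\<lambda>(a, b). f a b) r" for r
    by (simp add: T2_def kext_case_fext kext_bas L_def)
  ultimately show ?thesis by (simp add: kext_diff)
qed

lemma teq3D:
  assumes "teq3 scale p q"
    and f: "\<And>b c. lin (\<lambda>a. f a b c)" "\<And>a c. lin (\<lambda>b. f a b c)" "\<And>a b. lin (\<lambda>c. f a b c)"
  shows "kext (\<lambda>(a, b, c). f a b c) p = kext (\<lambda>(a, b, c). f a b c) q"
proof -
  define L where "L w = (case w of [a, b, c] \<Rightarrow> f a b c | _ \<Rightarrow> 0)" for w
  have "lin (\<lambda>x. L (u @ x # v))" for u v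
  proof (cases "length u + length v = 2")
    case True
    then have "(u = [] \<and> (\<exists>b c. v = [b, c])) \<or> (\<exists>a c. u = [a] \<and> v = [c]) \<or> (\<exists>a b. u = [a, b] \<and> v = [])"
      by (cases u; cases v; cases "tl u"; cases "tl v") auto
    then show ?thesis using f by (auto simp: L_def)
  next
    case False
    then have "L (u @ x # v) = 0" for x
      by (auto simp: L_def split: list.split) (auto simp: Cons_eq_append_conv append_eq_Cons_conv)
    then show ?thesis by (simp add: lin_def)
  qed
  then have "mlin L" by (rule mlinI)
  then have "kext L (T3 p - T3 q) = 0"
    using assms(1) unfolding teq3_def MLrel_def by (auto intro: kext_lspan kext_mlin_gens)
  moreover have "kext L (T3 r) = kext (\<lambda>(a, b, c). f a b c) r" for r
    by (simp add: T3_def kext_fext kext_bas L_def case_prod_unfold)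
  ultimately show ?thesis by (simp add: kext_diff)
qed

lemma lin_hext:
  fixes g :: "'z \<Rightarrow> 'h"
  assumes f: "lin f"
  shows "f (hext scale g p) = kext (\<lambda>x. f (g x)) p"
proof -
  have "f (0 + 0) = f 0 + f 0" using f unfolding lin_def by blast
  then have f0: "f 0 = 0" unfolding add_0_right by (metis add_cancel_right_right)
  have "f (sum G A) = (\<Sum>x\<in>A. f (G x))" for G and A :: "'z set"
    using f f0 by (induction A rule: infinite_finite_induct) (auto simp: lin_def)
  then show ?thesis using f by (simp add: hext_def kext_def lin_def)
qed

text \<open>\<open>Delta\<close> is linear only modulo the relations of H \<otimes> H, so linearity
  in the argument holds for bilinear \<open>f\<close>.\<close>

lemma lin_sw_arg:
  assumes "\<And>b. lin (\<lambda>a. f a b)" "\<And>a. lin (\<lambda>b. f a b)" "linH t"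
  shows "lin (\<lambda>x. swf (t x) f)"
proof -
  have "\<forall>x y. teq2 scale (Delta (x + y)) (Delta x + Delta y)"
    "\<forall>c x. teq2 scale (Delta (scale c x)) (smult c (Delta x))"
    using whopf unfolding weak_hopf_algebra_def by - (elim conjE, assumption)+
  then have *: "teq2 scale (Delta (x + y)) (Delta x + Delta y)"
    "teq2 scale (Delta (scale c x)) (smult c (Delta x))" for x y c
    by blast+
  have "lin (\<lambda>x. swf x f)"
    unfolding swf_def
    by (rule linI) (simp_all add: teq2D[OF *(1), OF assms(1,2)] teq2D[OF *(2), OF assms(1,2)] kext_add kext_smult)
  then show ?thesis using assms(3) by (rule lin_comp)
qed

text \<open>These rules discharge the side conditions of Sweedler manipulations. They are combined
  with a local fact \<open>f'\<close>, which says that \<open>f\<close> stays linear in an argument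
  after a \<open>linH\<close> or \<open>slot\<close> substitution.\<close>

lemmas lin_intros = mlinI lin_sw_body lin_sw_arg lin_times_left lin_times_right lin_eps
  linH_id linH_S linH_mult_left linH_mult_right slot_head slot_Cons slot_append_left slot_append_right

section \<open>The axioms of a cocommutative weak Hopf algebra as Sweedler identities\<close>

lemma sw_assoc:
  assumes f: "\<And>b c. lin (\<lambda>a. f a b c)" "\<And>a c. lin (\<lambda>b. f a b c)" "\<And>a b. lin (\<lambda>c. f a b c)"
  shows "swf h (\<lambda>a b. swf a (\<lambda>c d. f c d b)) = swf h (\<lambda>a b. swf b (\<lambda>c d. f a c d))"
proof -
  have "\<forall>h. teq3 scale (Delta2' Delta h) (Delta2 Delta h)"
    using whopf unfolding weak_hopf_algebra_def by (elim conjE)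
  from teq3D[OF spec[OF this], of f h] f show ?thesis
    by (simp add: swf_def Delta2_def Delta2'_def kext_fext kext_bas case_prod_unfold)
qed

lemma sw_comm:
  assumes f: "\<And>b. lin (\<lambda>a. f a b)" "\<And>a. lin (\<lambda>b. f a b)"
  shows "swf h (\<lambda>a b. f a b) = swf h (\<lambda>a b. f b a)"
proof -
  have "teq2 scale (Delta h) (fext (\<lambda>(a, b). bas (b, a)) (Delta h))"
    using cocomm unfolding cocommutative_def by blast
  from teq2D[OF this, of f] f show ?thesis
    by (simp add: swf_def kext_fext kext_bas case_prod_unfold)
qed

lemma sw_mult:
  assumes f: "\<And>b. lin (\<lambda>a. f a b)" "\<And>a. lin (\<lambda>b. f a b)"
  shows "swf (k * h) (\<lambda>a b. f a b) = swf k (\<lambda>a b. swf h (\<lambda>c d. f (a * c) (b * d)))"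
proof -
  have "\<forall>k h. teq2 scale (Delta (k * h))
        (fext (\<lambda>(a, b). fext (\<lambda>(a', b'). bas (a * a', b * b')) (Delta h)) (Delta k))"
    using whopf unfolding weak_hopf_algebra_def by (elim conjE)
  from teq2D[OF spec[OF spec[OF this]], of f k h] f show ?thesis
    by (simp add: swf_def kext_fext kext_bas case_prod_unfold)
qed

lemma sw_counit:
  assumes "lin f"
  shows "swf h (\<lambda>a b. eps a * f b) = f h" "swf h (\<lambda>a b. eps b * f a) = f h"
proof -
  have "\<forall>h. hext scale (\<lambda>(a, b). scale (eps a) b) (Delta h) = h"
    "\<forall>h. hext scale (\<lambda>(a, b). scale (eps b) a) (Delta h) = h"
    using whopf unfolding weak_hopf_algebra_def by - (elim conjE, assumption)+
  from this[THEN spec, THEN arg_cong[where f = f], of h] assms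
  show "swf h (\<lambda>a b. eps a * f b) = f h" "swf h (\<lambda>a b. eps b * f a) = f h"
    by (simp_all add: lin_hext[OF assms] swf_def case_prod_unfold) (simp_all add: lin_def)
qed

lemma eps_mult: "swf h (\<lambda>a b. eps (k * a) * eps (b * g)) = eps (k * h * g)"
    "swf h (\<lambda>a b. eps (k * b) * eps (a * g)) = eps (k * h * g)"
proof -
  have *: "\<forall>k h g. kext (\<lambda>(a, b). eps (k * a) * eps (b * g)) (Delta h) = eps (k * h * g)
           \<and> eps (k * h * g) = kext (\<lambda>(a, b). eps (k * b) * eps (a * g)) (Delta h)"
    using whopf unfolding weak_hopf_algebra_def by (elim conjE)
  show "swf h (\<lambda>a b. eps (k * a) * eps (b * g)) = eps (k * h * g)"
    using * unfolding swf_def by blast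
  show "swf h (\<lambda>a b. eps (k * b) * eps (a * g)) = eps (k * h * g)"
    unfolding swf_def using * by (metis (no_types, lifting))
qed

text \<open>The weak substitute for \<Delta>(1) = 1 \<otimes> 1: two copies of \<Delta>(1) that
  overlap in the middle factor, in either order, fuse into \<Delta>^2(1). Most arguments below
  create a second copy of \<Delta>(1) in order to fuse it.\<close>

lemma sw_one:
  assumes f: "\<And>b c. lin (\<lambda>a. f a b c)" "\<And>a c. lin (\<lambda>b. f a b c)" "\<And>a b. lin (\<lambda>c. f a b c)"
  shows "swf 1 (\<lambda>a b. swf b (\<lambda>c d. f a c d)) = swf 1 (\<lambda>a b. swf 1 (\<lambda>c d. f c (a * d) b))"
    and "swf 1 (\<lambda>a b. swf b (\<lambda>c d. f a c d)) = swf 1 (\<lambda>a b. swf 1 (\<lambda>c d. f c (d * a) b))"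
proof -
  have "teq3 scale (fext (\<lambda>(a, b). fext (\<lambda>(a', b'). bas (a', a * b', b)) (Delta 1)) (Delta 1))
                (Delta2 Delta 1)"
    "teq3 scale (Delta2 Delta 1)
                (fext (\<lambda>(a, b). fext (\<lambda>(a', b'). bas (a', b' * a, b)) (Delta 1)) (Delta 1))"
    using whopf unfolding weak_hopf_algebra_def by - (elim conjE, assumption)+
  from this[THEN teq3D, of f] f
  show "swf 1 (\<lambda>a b. swf b (\<lambda>c d. f a c d)) = swf 1 (\<lambda>a b. swf 1 (\<lambda>c d. f c (a * d) b))"
    and "swf 1 (\<lambda>a b. swf b (\<lambda>c d. f a c d)) = swf 1 (\<lambda>a b. swf 1 (\<lambda>c d. f c (d * a) b))"
    by (simp_all add: swf_def Delta2_def kext_fext kext_bas case_prod_unfold)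
qed

lemma sw_target:
  assumes "lin f"
  shows "swf h (\<lambda>a b. f (a * S b)) = swf 1 (\<lambda>a b. eps (a * h) * f b)"
proof -
  have "\<forall>h. hext scale (\<lambda>(a, b). a * S b) (Delta h) = hext scale (\<lambda>(a, b). scale (eps (a * h)) b) (Delta 1)"
    using whopf unfolding weak_hopf_algebra_def by (elim conjE)
  from arg_cong[where f = f, OF spec[OF this, of h]] assms show ?thesis
    by (simp add: lin_hext[OF assms] swf_def case_prod_unfold) (simp add: lin_def)
qed

lemma sw_source:
  assumes "lin f"
  shows "swf h (\<lambda>a b. f (S a * b)) = swf 1 (\<lambda>a b. eps (h * b) * f a)"
proof -
  have "\<forall>h. hext scale (\<lambda>(a, b). S a * b) (Delta h) = hext scale (\<lambda>(a, b). scale (eps (h * b)) a) (Delta 1)"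
    using whopf unfolding weak_hopf_algebra_def by (elim conjE)
  from arg_cong[where f = f, OF spec[OF this, of h]] assms show ?thesis
    by (simp add: lin_hext[OF assms] swf_def case_prod_unfold) (simp add: lin_def)
qed

lemma sw_antipode:
  assumes "lin f"
  shows "swf h (\<lambda>a b. swf b (\<lambda>c d. f (S a * c * S d))) = f (S h)"
proof -
  have "\<forall>h. S h = hext scale (\<lambda>(a, b, c). S a * b * S c) (Delta2 Delta h)"
    using whopf unfolding weak_hopf_algebra_def by (elim conjE)
  from arg_cong[where f = f, OF spec[OF this, of h]] show ?thesis
    by (simp add: lin_hext[OF assms] swf_def case_prod_unfold Delta2_def kext_fext kext_bas)
qed

text \<open>Coassociativity puts the first two legs into one coproduct, where cocommutativity swaps
  them.\<close>

lemma sw_swap12: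
  assumes f: "\<And>b c. lin (\<lambda>a. f a b c)" "\<And>a c. lin (\<lambda>b. f a b c)" "\<And>a b. lin (\<lambda>c. f a b c)"
  shows "swf h (\<lambda>a b. swf b (\<lambda>c d. f a c d)) = swf h (\<lambda>a b. swf b (\<lambda>c d. f c a d))"
proof -
  have "swf h (\<lambda>a b. swf b (\<lambda>c d. f a c d)) = swf h (\<lambda>a b. swf a (\<lambda>c d. f c d b))"
    by (rule sw_assoc[symmetric]) (rule f)+
  also have "\<dots> = swf h (\<lambda>a b. swf a (\<lambda>c d. f d c b))"
    by (intro sw_cong sw_comm f)
  also have "\<dots> = swf h (\<lambda>a b. swf b (\<lambda>c d. f c a d))"
    by (rule sw_assoc) (rule f)+
  finally show ?thesis .
qed

text \<open>Flattened to h_1, ..., h_4 by coassociativity, this is a transposition of the two middle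
  legs. It says that the comultiplication is itself a coalgebra map, and is the form in which
  cocommutativity is used most.\<close>

lemma sw_exchange:
  assumes f: "\<And>b c d. lin (\<lambda>a. f a b c d)" "\<And>a c d. lin (\<lambda>b. f a b c d)"
    "\<And>a b d. lin (\<lambda>c. f a b c d)" "\<And>a b c. lin (\<lambda>d. f a b c d)"
  shows "swf h (\<lambda>p q. swf p (\<lambda>a b. swf q (\<lambda>c d. f a b c d)))
       = swf h (\<lambda>p q. swf p (\<lambda>a b. swf q (\<lambda>c d. f a c b d)))"
proof -
  have *: "swf h (\<lambda>p q. swf p (\<lambda>a b. swf q (\<lambda>c d. g a b c d)))
      = swf h (\<lambda>a y. swf y (\<lambda>b q. swf q (\<lambda>c d. g a b c d)))"
    if g: "\<And>b c d. lin (\<lambda>a. g a b c d)" "\<And>a c d. lin (\<lambda>b. g a b c d)"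
    "\<And>a b d. lin (\<lambda>c. g a b c d)" "\<And>a b c. lin (\<lambda>d. g a b c d)" for g
    by (rule sw_assoc[where f = "\<lambda>a b q. swf q (\<lambda>c d. g a b c d)"])
      (intro lin_intros g[THEN lin_comp])+
  have "swf h (\<lambda>p q. swf p (\<lambda>a b. swf q (\<lambda>c d. f a b c d)))
      = swf h (\<lambda>a y. swf y (\<lambda>b q. swf q (\<lambda>c d. f a b c d)))"
    by (rule *) (rule f)+
  also have "\<dots> = swf h (\<lambda>a y. swf y (\<lambda>b q. swf q (\<lambda>c d. f a c b d)))"
    by (intro sw_cong sw_swap12 f)
  also have "\<dots> = swf h (\<lambda>p q. swf p (\<lambda>a b. swf q (\<lambda>c d. f a c b d)))"
    by (rule *[symmetric]) (rule f)+
  finally show ?thesis .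
qed

subsection \<open>Source and target maps\<close>

text \<open>The target element k_2 S(k_3) is a leg of \<Delta>(1) weighted by \<open>eps\<close>.
  Writing \<open>k\<close> as \<open>1 * k\<close> supplies a second \<Delta>(1); the two fuse into
  \<Delta>^2(1), and the counit removes the weight.\<close>

lemma sw_target_right:
  assumes f: "\<And>b. lin (\<lambda>a. f a b)" "\<And>a. lin (\<lambda>b. f a b)"
  shows "swf k (\<lambda>a b. swf b (\<lambda>c d. f a (c * S d))) = swf 1 (\<lambda>p q. f (p * k) q)"
proof -
  note f' = f[THEN lin_comp]
  have "swf k (\<lambda>a b. swf b (\<lambda>c d. f a (c * S d)))
      = swf k (\<lambda>x y. swf 1 (\<lambda>a b. eps (a * y) * f x b))"
    by (intro sw_cong sw_target f)
  also have "\<dots> = swf 1 (\<lambda>a b. swf (1 * k) (\<lambda>x y. eps (a * y) * f x b))"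
    by (simp only: mult_1_left) (rule sw_swap)
  also have "\<dots> = swf 1 (\<lambda>a b. swf 1 (\<lambda>c d. swf k (\<lambda>x y. eps (a * (d * y)) * f (c * x) b)))"
    by (rule sw_cong, rule sw_mult) (intro lin_intros f')+
  also have "\<dots> = swf 1 (\<lambda>p q. swf q (\<lambda>c d. swf k (\<lambda>x y. eps (c * y) * f (p * x) d)))"
    by (subst sw_one(1)[where f = "\<lambda>p c d. swf k (\<lambda>x y. eps (c * y) * f (p * x) d)"])
      ((intro lin_intros f')+, simp only: mult.assoc)
  also have "\<dots> = swf 1 (\<lambda>p q. swf p (\<lambda>c d. swf k (\<lambda>x y. eps (d * y) * f (c * x) q)))"
    by (rule sw_assoc[where f = "\<lambda>p c d. swf k (\<lambda>x y. eps (c * y) * f (p * x) d)", symmetric])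
      (intro lin_intros f')+
  also have "\<dots> = swf 1 (\<lambda>p q. swf (p * k) (\<lambda>x y. eps y * f x q))"
    by (rule sw_cong, rule sw_mult[symmetric]) (intro lin_intros f')+
  also have "\<dots> = swf 1 (\<lambda>p q. f (p * k) q)"
    by (intro sw_cong sw_counit f)
  finally show ?thesis .
qed

lemma sw_source_left:
  assumes f: "\<And>b. lin (\<lambda>a. f a b)" "\<And>a. lin (\<lambda>b. f a b)"
  shows "swf k (\<lambda>a b. swf a (\<lambda>c d. f (S c * d) b)) = swf 1 (\<lambda>p q. f p (k * q))"
proof -
  note f' = f[THEN lin_comp]
  have "swf k (\<lambda>a b. swf a (\<lambda>c d. f (S c * d) b))
      = swf k (\<lambda>x y. swf 1 (\<lambda>a b. eps (x * b) * f a y))"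
    by (intro sw_cong sw_source f)
  also have "\<dots> = swf 1 (\<lambda>a b. swf (k * 1) (\<lambda>x y. eps (x * b) * f a y))"
    by (simp only: mult_1_right) (rule sw_swap)
  also have "\<dots> = swf 1 (\<lambda>a b. swf k (\<lambda>x y. swf 1 (\<lambda>c d. eps (x * c * b) * f a (y * d))))"
    by (rule sw_cong, rule sw_mult) (intro lin_intros f')+
  also have "\<dots> = swf 1 (\<lambda>a b. swf 1 (\<lambda>c d. swf k (\<lambda>x y. eps (x * c * b) * f a (y * d))))"
    by (rule sw_cong, rule sw_swap)
  also have "\<dots> = swf 1 (\<lambda>a b. swf 1 (\<lambda>c d. swf k (\<lambda>x y. eps (x * (a * d)) * f c (y * b))))"
    by (subst sw_swap) (simp only: mult.assoc)
  also have "\<dots> = swf 1 (\<lambda>p q. swf q (\<lambda>c d. swf k (\<lambda>x y. eps (x * c) * f p (y * d))))"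
    by (rule sw_one(1)[where f = "\<lambda>p c d. swf k (\<lambda>x y. eps (x * c) * f p (y * d))", symmetric])
      (intro lin_intros f')+
  also have "\<dots> = swf 1 (\<lambda>p q. swf (k * q) (\<lambda>x y. eps x * f p y))"
    by (rule sw_cong, subst sw_swap, rule sw_mult[symmetric]) (intro lin_intros f')+
  also have "\<dots> = swf 1 (\<lambda>p q. f p (k * q))"
    by (intro sw_cong sw_counit f)
  finally show ?thesis .
qed

lemma sw_target_one: "lin f \<Longrightarrow> swf 1 (\<lambda>a b. f (a * S b)) = f 1"
  by (simp add: sw_target sw_counit)

lemma sw_source_one: "lin f \<Longrightarrow> swf 1 (\<lambda>a b. f (S a * b)) = f 1"
  by (simp add: sw_source sw_counit)

text \<open>A source element comes from the first leg of \<Delta>(1), a target element from the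
  second. Their product in either order is therefore the middle leg of \<Delta>^2(1), weighted by
  \<open>eps\<close> on the outer legs.\<close>

lemma sw_source_target_commute:
  assumes f: "lin f"
  shows "swf h (\<lambda>a b. swf g (\<lambda>c d. f (S a * b * (c * S d))))
       = swf h (\<lambda>a b. swf g (\<lambda>c d. f (c * S d * (S a * b))))"
proof -
  note f' = f[THEN lin_comp]
  have "swf h (\<lambda>a b. swf g (\<lambda>c d. f (S a * b * (c * S d))))
      = swf 1 (\<lambda>a b. eps (h * b) * swf g (\<lambda>c d. f (a * (c * S d))))"
    by (rule sw_source[where f = "\<lambda>z. swf g (\<lambda>c d. f (z * (c * S d)))"]) (intro lin_intros f')+
  also have "\<dots> = swf 1 (\<lambda>a b. eps (h * b) * swf 1 (\<lambda>c d. eps (c * g) * f (a * d)))"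
    by (intro sw_cong arg_cong[where f = "(*) _"] sw_target lin_intros f')
  also have "\<dots> = swf 1 (\<lambda>a b. swf 1 (\<lambda>c d. eps (h * b) * (eps (c * g) * f (a * d))))"
    by (simp only: sw_times)
  also have "\<dots> = swf 1 (\<lambda>a b. swf 1 (\<lambda>c d. eps (h * b) * (eps (c * g) * f (d * a))))"
    by (rule trans[OF sw_one(1)[symmetric] sw_one(2)]) (intro lin_intros f')+
  also have "\<dots> = swf 1 (\<lambda>a b. eps (h * b) * swf 1 (\<lambda>c d. eps (c * g) * f (d * a)))"
    by (simp only: sw_times)
  also have "\<dots> = swf 1 (\<lambda>a b. eps (h * b) * swf g (\<lambda>c d. f (c * S d * a)))"
    by (intro sw_cong arg_cong[where f = "(*) _"] sw_target[symmetric] lin_intros f')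
  also have "\<dots> = swf h (\<lambda>a b. swf g (\<lambda>c d. f (c * S d * (S a * b))))"
    by (rule sw_source[where f = "\<lambda>z. swf g (\<lambda>c d. f (c * S d * z))", symmetric]) (intro lin_intros f')+
  finally show ?thesis .
qed

text \<open>Expanding the target element of \<open>g\<close> and writing \<open>h\<close> as
  \<open>h * 1\<close> brings two copies of \<Delta>(1) together. Once fused they leave the target
  element of h 1_2 weighted by \<epsilon>(1_1 g), and weak multiplicativity of \<open>eps\<close>
  eliminates 1_1 and 1_2.\<close>

lemma sw_target_mult:
  assumes f: "lin f"
  shows "swf (h * g) (\<lambda>a b. f (a * S b)) = swf h (\<lambda>a b. swf g (\<lambda>c d. f (a * (c * S d) * S b)))"
proof -
  note f' = f[THEN lin_comp]
  have "swf h (\<lambda>a b. swf g (\<lambda>c d. f (a * (c * S d) * S b)))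
      = swf h (\<lambda>a b. swf 1 (\<lambda>p q. eps (p * g) * f (a * q * S b)))"
    by (intro sw_cong sw_target lin_intros f')
  also have "\<dots> = swf 1 (\<lambda>p q. eps (p * g) * swf (h * 1) (\<lambda>a b. f (a * q * S b)))"
    by (subst sw_swap) (simp only: sw_times mult_1_right)
  also have "\<dots> = swf 1 (\<lambda>p q. eps (p * g) * swf h (\<lambda>a b. swf 1 (\<lambda>c d. f (a * c * q * S (b * d)))))"
    by (intro sw_cong arg_cong[where f = "(*) _"] sw_mult lin_intros f')
  also have "\<dots> = swf 1 (\<lambda>p q. swf 1 (\<lambda>c d. eps (p * g) * swf h (\<lambda>a b. f (a * (c * q) * S (b * d)))))"
    by (subst sw_swap[of h]) (simp only: sw_times mult.assoc)
  also have "\<dots> = swf 1 (\<lambda>a b. swf 1 (\<lambda>p q. eps (p * g) * swf h (\<lambda>x y. f (x * (a * q) * S (y * b)))))"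
    by (rule sw_swap)
  also have "\<dots> = swf 1 (\<lambda>p q. swf q (\<lambda>c d. eps (p * g) * swf h (\<lambda>x y. f (x * c * S (y * d)))))"
    by (rule sw_one(1)[where f = "\<lambda>p c d. eps (p * g) * swf h (\<lambda>x y. f (x * c * S (y * d)))", symmetric])
     (intro lin_intros f')+
  also have "\<dots> = swf 1 (\<lambda>p q. eps (p * g) * swf (h * q) (\<lambda>x y. f (x * S y)))"
    by (simp only: sw_times, intro sw_cong arg_cong[where f = "(*) _"], subst sw_swap,
        intro sw_mult[symmetric] lin_intros f')
  also have "\<dots> = swf 1 (\<lambda>p q. eps (p * g) * swf 1 (\<lambda>a b. eps (a * (h * q)) * f b))"
    by (intro sw_cong arg_cong[where f = "(*) _"] sw_target f)
  also have "\<dots> = swf 1 (\<lambda>p q. swf 1 (\<lambda>a b. f b * (eps (a * h * q) * eps (p * g))))"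
    by (simp only: sw_times[symmetric] mult.assoc) (simp only: mult_ac)
  also have "\<dots> = swf 1 (\<lambda>a b. f b * swf 1 (\<lambda>p q. eps (a * h * q) * eps (p * g)))"
    by (subst sw_swap) (simp only: sw_times)
  also have "\<dots> = swf 1 (\<lambda>a b. eps (a * (h * g)) * f b)"
    by (simp only: eps_mult mult_1_right) (simp only: mult_ac)
  also have "\<dots> = swf (h * g) (\<lambda>a b. f (a * S b))"
    by (rule sw_target[symmetric]) (rule f)
  finally show ?thesis by (rule sym)
qed

lemma sw_source_mult:
  assumes f: "lin f"
  shows "swf (h * g) (\<lambda>a b. f (S a * b)) = swf g (\<lambda>c d. swf h (\<lambda>a b. f (S c * (S a * b) * d)))"
proof -
  note f' = f[THEN lin_comp]
  have "swf g (\<lambda>c d. swf h (\<lambda>a b. f (S c * (S a * b) * d)))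
      = swf g (\<lambda>c d. swf 1 (\<lambda>p q. eps (h * q) * f (S c * p * d)))"
    by (intro sw_cong sw_source lin_intros f')
  also have "\<dots> = swf 1 (\<lambda>p q. eps (h * q) * swf (1 * g) (\<lambda>a b. f (S a * p * b)))"
    by (subst sw_swap) (simp only: sw_times mult_1_left)
  also have "\<dots> = swf 1 (\<lambda>p q. eps (h * q) * swf 1 (\<lambda>c d. swf g (\<lambda>a b. f (S (c * a) * p * (d * b)))))"
    by (intro sw_cong arg_cong[where f = "(*) _"] sw_mult lin_intros f')
  also have "\<dots> = swf 1 (\<lambda>p q. swf 1 (\<lambda>c d. eps (h * q) * swf g (\<lambda>a b. f (S (c * a) * (p * d) * b))))"
    by (simp only: sw_times mult.assoc)
  also have "\<dots> = swf 1 (\<lambda>p q. swf q (\<lambda>c d. eps (h * d) * swf g (\<lambda>x y. f (S (p * x) * c * y))))"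
    by (rule sw_one(1)[where f = "\<lambda>p c d. eps (h * d) * swf g (\<lambda>x y. f (S (p * x) * c * y))", symmetric])
     (intro lin_intros f')+
  also have "\<dots> = swf 1 (\<lambda>p q. swf p (\<lambda>c d. eps (h * q) * swf g (\<lambda>x y. f (S (c * x) * d * y))))"
    by (rule sw_assoc[where f = "\<lambda>p c d. eps (h * d) * swf g (\<lambda>x y. f (S (p * x) * c * y))", symmetric])
     (intro lin_intros f')+
  also have "\<dots> = swf 1 (\<lambda>p q. eps (h * q) * swf (p * g) (\<lambda>x y. f (S x * y)))"
    by (simp only: sw_times mult.assoc, intro sw_cong arg_cong[where f = "(*) _"] sw_mult[symmetric] lin_intros f')
  also have "\<dots> = swf 1 (\<lambda>p q. eps (h * q) * swf 1 (\<lambda>a b. eps (p * g * b) * f a))"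
    by (intro sw_cong arg_cong[where f = "(*) _"] sw_source f)
  also have "\<dots> = swf 1 (\<lambda>p q. swf 1 (\<lambda>a b. f a * (eps (h * q) * eps (p * (g * b)))))"
    by (simp only: sw_times[symmetric] mult.assoc) (simp only: mult_ac)
  also have "\<dots> = swf 1 (\<lambda>a b. f a * swf 1 (\<lambda>p q. eps (h * q) * eps (p * (g * b))))"
    by (subst sw_swap) (simp only: sw_times)
  also have "\<dots> = swf 1 (\<lambda>a b. eps (h * g * b) * f a)"
    by (simp only: eps_mult mult_1_right) (simp only: mult_ac)
  also have "\<dots> = swf (h * g) (\<lambda>a b. f (S a * b))"
    by (rule sw_source[symmetric]) (rule f)
  finally show ?thesis by (rule sym)
qed

subsection \<open>The antipode\<close>

lemma eq_if_lin_eq: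
  assumes "\<And>f. lin f \<Longrightarrow> f x = f y"
  shows "x = y"
proof (rule ccontr)
  assume "x \<noteq> y"
  have vs: "vector_space scale"
    using whopf unfolding weak_hopf_algebra_def by (elim conjE)
  interpret vector_space_pair scale "(*) :: 'k \<Rightarrow> 'k \<Rightarrow> 'k"
    by (rule vector_space_pair.intro[OF vs]) (unfold_locales, auto simp: algebra_simps)
  have "\<not> vs1.dependent {x - y}"
    using \<open>x \<noteq> y\<close> by (simp add: vs1.dependent_single)
  then obtain L where L: "Vector_Spaces.linear scale (*) L" "\<forall>z\<in>{x - y}. L z = 1"
    using linear_independent_extend[of "{x - y}" "\<lambda>_. 1"] by blast
  have "lin L"
    by (rule linI) (simp_all add: linear_add[OF L(1)] linear_scale[OF L(1)])
  then have "L x = L y" by (rule assms)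
  then show False using L by (simp add: linear_diff)
qed

lemma sw_antipode':
  assumes f: "lin f"
  shows "swf h (\<lambda>p c. swf p (\<lambda>a b. f (S a * b * S c))) = f (S h)"
  by (rule trans[OF sw_assoc[where f = "\<lambda>a b c. f (S a * b * S c)"] sw_antipode])
    (intro lin_intros f[THEN lin_comp] f)+

text \<open>\<open>S(hg)\<close> and \<open>S(g)S(h)\<close> are both generalized convolution inverses of the multiplication
  \<open>H \<otimes> H \<rightarrow> H\<close> with the same one-sided products, hence equal.\<close>

lemma S_mult: "S (h * g) = S g * S h"
proof (rule eq_if_lin_eq)
  fix f assume f: "lin f"
  note f' = f[THEN lin_comp]
  have "f (S (h * g)) = swf (h * g) (\<lambda>x y. swf y (\<lambda>b c. f (S x * (b * S c))))"
    by (simp only: sw_antipode[OF f, symmetric] mult.assoc)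
  also have "\<dots> = swf h (\<lambda>a b. swf g (\<lambda>c d. swf (b * d) (\<lambda>x y. f (S (a * c) * (x * S y)))))"
    by (rule sw_mult) (intro lin_intros f')+
  also have "\<dots> = swf h (\<lambda>a b. swf g (\<lambda>c d. swf b (\<lambda>b1 b2. swf d (\<lambda>d1 d2.
      f (S (a * c) * (b1 * (d1 * S d2) * S b2))))))"
    by (intro sw_cong sw_target_mult lin_intros f')
  also have "\<dots> = swf h (\<lambda>a b. swf b (\<lambda>b1 b2. swf g (\<lambda>c d. swf d (\<lambda>d1 d2.
      f (S (a * c) * (b1 * (d1 * S d2) * S b2))))))"
    by (rule sw_cong, rule sw_swap)
  also have "\<dots> = swf h (\<lambda>a b. swf a (\<lambda>a1 a2. swf g (\<lambda>c d. swf d (\<lambda>d1 d2.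
      f (S (a1 * c) * (a2 * (d1 * S d2) * S b))))))"
    by (rule sw_assoc[symmetric, where f = "\<lambda>a b1 b2. swf g (\<lambda>c d. swf d (\<lambda>d1 d2.
      f (S (a * c) * (b1 * (d1 * S d2) * S b2))))"]) (intro lin_intros f')+
  also have "\<dots> = swf h (\<lambda>a b. swf a (\<lambda>a1 a2. swf g (\<lambda>c d. swf c (\<lambda>c1 c2.
      f (S (a1 * c1) * (a2 * (c2 * S d) * S b))))))"
    by (rule sw_cong, rule sw_cong, rule sw_assoc[symmetric]) (intro lin_intros f')+
  also have "\<dots> = swf h (\<lambda>a b. swf g (\<lambda>c d. swf a (\<lambda>a1 a2. swf c (\<lambda>c1 c2.
      f (S (a1 * c1) * (a2 * c2) * (S d * S b))))))"
    by (subst sw_swap[of g]) (simp only: mult.assoc)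
  also have "\<dots> = swf h (\<lambda>a b. swf g (\<lambda>c d. swf (a * c) (\<lambda>x y. f (S x * y * (S d * S b)))))"
    by (intro sw_cong sw_mult[symmetric] lin_intros f')
  also have "\<dots> = swf h (\<lambda>a b. swf g (\<lambda>c d. swf c (\<lambda>c1 c2. swf a (\<lambda>a1 a2.
      f (S c1 * (S a1 * a2) * c2 * (S d * S b))))))"
    by (intro sw_cong sw_source_mult[where f = "\<lambda>z. f (z * _)"] lin_intros f')
  also have "\<dots> = swf h (\<lambda>a b. swf g (\<lambda>c d. swf d (\<lambda>d1 d2. swf a (\<lambda>a1 a2.
      f (S c * (S a1 * a2) * d1 * (S d2 * S b))))))"
    by (rule sw_cong, rule sw_assoc) (intro lin_intros f')+
  also have "\<dots> = swf h (\<lambda>a b. swf g (\<lambda>c d. swf a (\<lambda>a1 a2. swf d (\<lambda>d1 d2.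
      f (S c * (S a1 * a2 * (d1 * S d2)) * S b)))))"
    by (subst sw_swap) (simp only: mult.assoc)
  \<comment> \<open>The source element of \<open>h\<close> now stands next to the target element of
    \<open>g\<close>. Exchanging them joins each to the antipode that completes it to S(g) or
    S(h).\<close>
  also have "\<dots> = swf h (\<lambda>a b. swf g (\<lambda>c d. swf a (\<lambda>a1 a2. swf d (\<lambda>d1 d2.
      f (S c * (d1 * S d2 * (S a1 * a2)) * S b)))))"
    by (intro sw_cong sw_source_target_commute[where f = "\<lambda>z. f (S _ * z * S _)"] lin_intros f')
  also have "\<dots> = swf h (\<lambda>a b. swf a (\<lambda>a1 a2. swf g (\<lambda>c d. swf d (\<lambda>d1 d2.
      f (S c * d1 * S d2 * (S a1 * a2 * S b))))))"
    by (subst sw_swap[of g]) (simp only: mult.assoc)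
  also have "\<dots> = swf h (\<lambda>a b. swf a (\<lambda>a1 a2. f (S g * (S a1 * a2 * S b))))"
    by (intro sw_cong sw_antipode[where f = "\<lambda>z. f (z * _)"] lin_intros f')
  also have "\<dots> = f (S g * S h)"
    by (intro sw_antipode' lin_intros f')
  finally show "f (S (h * g)) = f (S g * S h)" .
qed

text \<open>The target element is a leg of \<Delta>(1), so its coproduct is part of \<Delta>^2(1),
  which splits again into two copies of \<Delta>(1). Reading these back with
  \<open>sw_target_right\<close> gives h_1 S(h_4) \<otimes> h_2 S(h_3), and cocommutativity reorders
  the legs.\<close>

lemma sw_comult_target:
  assumes f: "\<And>b. lin (\<lambda>a. f a b)" "\<And>a. lin (\<lambda>b. f a b)"
  shows "swf h (\<lambda>a b. swf (a * S b) (\<lambda>x y. f x y))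
       = swf h (\<lambda>p q. swf p (\<lambda>a b. swf q (\<lambda>c d. f (a * S b) (c * S d))))"
proof -
  note f' = f[THEN lin_comp]
  have "swf h (\<lambda>a b. swf (a * S b) (\<lambda>x y. f x y)) = swf 1 (\<lambda>a b. eps (a * h) * swf b (\<lambda>x y. f x y))"
    by (rule sw_target[where f = "\<lambda>z. swf z (\<lambda>x y. f x y)"]) (intro lin_intros f')+
  also have "\<dots> = swf 1 (\<lambda>p q. swf q (\<lambda>c d. eps (p * h) * f c d))"
    by (simp only: sw_times)
  also have "\<dots> = swf 1 (\<lambda>a b. swf 1 (\<lambda>c d. eps (c * h) * f (a * d) b))"
    by (rule sw_one(1)) (intro lin_intros f')+
  also have "\<dots> = swf 1 (\<lambda>c d. eps (c * h) * swf 1 (\<lambda>a b. f (a * d) b))"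
    by (subst sw_swap) (simp only: sw_times)
  also have "\<dots> = swf h (\<lambda>x y. swf 1 (\<lambda>a b. f (a * (x * S y)) b))"
    by (rule sw_target[symmetric, where f = "\<lambda>z. swf 1 (\<lambda>a b. f (a * z) b)"]) (intro lin_intros f')+
  also have "\<dots> = swf h (\<lambda>x y. swf x (\<lambda>a b. swf b (\<lambda>c d. f (a * S y) (c * S d))))"
    by (subst sw_target_right[where f = "\<lambda>p q. f (p * S y) q" for y])
      ((intro lin_intros f')+, simp only: mult.assoc)
  also have "\<dots> = swf h (\<lambda>a z. swf z (\<lambda>b y. swf b (\<lambda>c d. f (a * S y) (c * S d))))"
    by (rule sw_assoc) (intro lin_intros f')+
  also have "\<dots> = swf h (\<lambda>a z. swf z (\<lambda>y b. swf b (\<lambda>c d. f (a * S y) (c * S d))))"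
    by (intro sw_cong sw_comm lin_intros f')
  also have "\<dots> = swf h (\<lambda>p q. swf p (\<lambda>a b. swf q (\<lambda>c d. f (a * S b) (c * S d))))"
    by (rule sw_assoc[symmetric]) (intro lin_intros f')+
  finally show ?thesis .
qed

lemma sw_comult_source:
  assumes f: "\<And>b. lin (\<lambda>a. f a b)" "\<And>a. lin (\<lambda>b. f a b)"
  shows "swf h (\<lambda>a b. swf (S a * b) (\<lambda>x y. f x y))
       = swf h (\<lambda>p q. swf p (\<lambda>a b. swf q (\<lambda>c d. f (S a * b) (S c * d))))"
proof -
  note f' = f[THEN lin_comp]
  have "swf h (\<lambda>a b. swf (S a * b) (\<lambda>x y. f x y)) = swf 1 (\<lambda>a b. eps (h * b) * swf a (\<lambda>x y. f x y))"
    by (rule sw_source[where f = "\<lambda>z. swf z (\<lambda>x y. f x y)"]) (intro lin_intros f')+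
  also have "\<dots> = swf 1 (\<lambda>p q. swf p (\<lambda>c d. eps (h * q) * f c d))"
    by (simp only: sw_times)
  also have "\<dots> = swf 1 (\<lambda>p q. swf q (\<lambda>c d. eps (h * d) * f p c))"
    by (rule sw_assoc) (intro lin_intros f')+
  also have "\<dots> = swf 1 (\<lambda>a b. swf 1 (\<lambda>c d. eps (h * b) * f c (a * d)))"
    by (rule sw_one(1)) (intro lin_intros f')+
  also have "\<dots> = swf 1 (\<lambda>a b. eps (h * b) * swf 1 (\<lambda>c d. f c (a * d)))"
    by (simp only: sw_times)
  also have "\<dots> = swf h (\<lambda>x y. swf 1 (\<lambda>c d. f c (S x * y * d)))"
    by (rule sw_source[symmetric, where f = "\<lambda>z. swf 1 (\<lambda>a b. f a (z * b))"]) (intro lin_intros f')+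
  also have "\<dots> = swf h (\<lambda>x y. swf y (\<lambda>a b. swf a (\<lambda>c d. f (S c * d) (S x * b))))"
    by (subst sw_source_left[where f = "\<lambda>p q. f p (S x * q)" for x])
      ((intro lin_intros f')+, simp only: mult.assoc)
  also have "\<dots> = swf h (\<lambda>p q. swf q (\<lambda>a b. swf p (\<lambda>c d. f (S c * d) (S a * b))))"
    by (rule sw_swap12) (intro lin_intros f')+
  also have "\<dots> = swf h (\<lambda>p q. swf p (\<lambda>a b. swf q (\<lambda>c d. f (S a * b) (S c * d))))"
    by (rule sw_cong, rule sw_swap)
  finally show ?thesis .
qed

text \<open>Likewise \<open>h \<mapsto> Delta (S h)\<close> and \<open>h \<mapsto> S h\<^sub>1 \<otimes> S h\<^sub>2\<close> are generalized convolution inverses of \<open>Delta\<close>.\<close>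

lemma sw_S:
  assumes f: "\<And>b. lin (\<lambda>a. f a b)" "\<And>a. lin (\<lambda>b. f a b)"
  shows "swf (S h) (\<lambda>a b. f a b) = swf h (\<lambda>a b. f (S a) (S b))"
proof -
  note f' = f[THEN lin_comp]
  have "swf (S h) (\<lambda>a b. f a b) = swf h (\<lambda>a y. swf y (\<lambda>b c. swf (S a * (b * S c)) (\<lambda>a b. f a b)))"
    by (subst sw_antipode[where f = "\<lambda>z. swf z (\<lambda>x y. f x y)", symmetric])
      ((intro lin_intros f')+, simp only: mult.assoc)
  also have "\<dots> = swf h (\<lambda>a y. swf y (\<lambda>b c. swf (S a) (\<lambda>s t. swf (b * S c) (\<lambda>u v. f (s * u) (t * v)))))"
    by (intro sw_cong sw_mult f)
  also have "\<dots> = swf h (\<lambda>a y. swf (S a) (\<lambda>s t. swf y (\<lambda>b c. swf (b * S c) (\<lambda>u v. f (s * u) (t * v)))))"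
    by (rule sw_cong, rule sw_swap)
  also have "\<dots> = swf h (\<lambda>a y. swf (S a) (\<lambda>s t. swf y (\<lambda>p q. swf p (\<lambda>b c. swf q (\<lambda>d e.
      f (s * (b * S c)) (t * (d * S e)))))))"
    by (rule sw_cong, rule sw_cong, rule sw_comult_target) (intro lin_intros f')+
  also have "\<dots> = swf h (\<lambda>a y. swf (S a) (\<lambda>s t. swf y (\<lambda>p q. swf p (\<lambda>b d. swf q (\<lambda>c e.
      f (s * (b * S c)) (t * (d * S e)))))))"
    by (rule sw_cong, rule sw_cong, rule sw_exchange) (intro lin_intros f')+
  also have "\<dots> = swf h (\<lambda>a y. swf y (\<lambda>p q. swf (S a) (\<lambda>s t. swf p (\<lambda>b d. swf q (\<lambda>c e.
      f (s * b * S c) (t * d * S e))))))"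
    by (simp only: mult.assoc, rule sw_cong, rule sw_swap)
  also have "\<dots> = swf h (\<lambda>a y. swf y (\<lambda>p q. swf (S a * p) (\<lambda>u v. swf q (\<lambda>c e. f (u * S c) (v * S e)))))"
    by (intro sw_cong sw_mult[symmetric] lin_intros f')
  also have "\<dots> = swf h (\<lambda>x q. swf x (\<lambda>a p. swf (S a * p) (\<lambda>u v. swf q (\<lambda>c e. f (u * S c) (v * S e)))))"
    by (rule sw_assoc[symmetric]) (intro lin_intros f')+
  also have "\<dots> = swf h (\<lambda>x q. swf x (\<lambda>p p'. swf p (\<lambda>a b. swf p' (\<lambda>a' b'. swf q (\<lambda>c e.
      f (S a * b * S c) (S a' * b' * S e))))))"
    by (rule sw_cong, rule sw_comult_source) (intro lin_intros f')+
  also have "\<dots> = swf h (\<lambda>x q. swf x (\<lambda>p p'. swf q (\<lambda>c e. swf p (\<lambda>a b. swf p' (\<lambda>a' b'.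
      f (S a * b * S c) (S a' * b' * S e))))))"
    by (rule sw_cong, rule sw_cong, subst (2) sw_swap, rule sw_swap)
  \<comment> \<open>After this exchange each tensor factor carries three consecutive legs of
    \<open>h\<close>, and the antipode axiom contracts both separately.\<close>
  also have "\<dots> = swf h (\<lambda>x q. swf x (\<lambda>p c. swf q (\<lambda>p' e. swf p (\<lambda>a b. swf p' (\<lambda>a' b'.
      f (S a * b * S c) (S a' * b' * S e))))))"
    by (rule sw_exchange) (intro lin_intros f')+
  also have "\<dots> = swf h (\<lambda>x q. swf x (\<lambda>p c. swf p (\<lambda>a b. swf q (\<lambda>p' e. swf p' (\<lambda>a' b'.
      f (S a * b * S c) (S a' * b' * S e))))))"
    by (rule sw_cong, rule sw_cong, rule sw_swap)
  also have "\<dots> = swf h (\<lambda>x q. swf x (\<lambda>p c. swf p (\<lambda>a b. f (S a * b * S c) (S q))))"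
    by (intro sw_cong sw_antipode' f)
  also have "\<dots> = swf h (\<lambda>x q. f (S x) (S q))"
    by (rule sw_cong, rule sw_antipode') (rule f)
  finally show ?thesis .
qed

text \<open>The relations of H_par contain letters \<open>S b\<close>, whereas target and source
  identities produce bare legs of \<Delta>(1). This lemma converts one into the other.\<close>

lemma sw_one_S:
  assumes f: "\<And>b. lin (\<lambda>a. f a b)" "\<And>a. lin (\<lambda>b. f a b)"
  shows "swf 1 (\<lambda>a b. f a (S b)) = swf 1 (\<lambda>a b. f a b)"
proof -
  note f' = f[THEN lin_comp]
  \<comment> \<open>The factor 1 = 1_1 S(1_2), its legs swapped by cocommutativity, is inserted
    before \<open>S y\<close>; it is the second \<Delta>(1) that \<open>sw_one\<close>
    needs.\<close>
  have "swf 1 (\<lambda>a b. f a (S b)) = swf 1 (\<lambda>x y. swf 1 (\<lambda>a b. f x (b * S a * S y)))"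
  proof (intro sw_cong)
    fix x y
    have "f x (1 * S y) = swf 1 (\<lambda>a b. f x (a * S b * S y))"
      by (rule sw_target_one[where f = "\<lambda>z. f x (z * S y)", symmetric]) (intro lin_intros f')
    also have "\<dots> = swf 1 (\<lambda>a b. f x (b * S a * S y))"
      by (rule sw_comm) (intro lin_intros f')+
    finally show "f x (S y) = swf 1 (\<lambda>a b. f x (b * S a * S y))" by simp
  qed
  also have "\<dots> = swf 1 (\<lambda>a b. swf 1 (\<lambda>c d. f c (b * S (d * a))))"
    by (subst sw_swap) (simp only: S_mult mult.assoc)
  also have "\<dots> = swf 1 (\<lambda>a b. swf b (\<lambda>c d. f a (d * S c)))"
    by (rule sw_one(2)[symmetric]) (intro lin_intros f')+
  also have "\<dots> = swf 1 (\<lambda>a b. swf b (\<lambda>c d. f a (c * S d)))"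
    by (intro sw_cong sw_comm lin_intros f')
  also have "\<dots> = swf 1 (\<lambda>p q. f (p * 1) q)"
    by (rule sw_target_right) (rule f)+
  finally show ?thesis by simp
qed

lemma S_one: "S 1 = 1"
proof (rule eq_if_lin_eq)
  fix f assume f: "lin f"
  note f' = f[THEN lin_comp]
  have "f (S 1) = swf 1 (\<lambda>a b. swf b (\<lambda>c d. f (S a * (c * S d))))"
    by (simp only: sw_antipode[OF f, symmetric] mult.assoc)
  also have "\<dots> = swf 1 (\<lambda>p q. f (S (p * 1) * q))"
    by (rule sw_target_right) (intro lin_intros f')+
  also have "\<dots> = f 1"
    by (simp add: sw_source_one f)
  finally show "f (S 1) = f 1" .
qed

section \<open>Words and linear forms on the partial Hopf algebra\<close>

primrec Dw :: "'h list \<Rightarrow> ('h list \<times> 'h list \<Rightarrow>\<^sub>0 'k)" where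
  "Dw [] = bas ([], [])"
| "Dw (x # w) = fext (\<lambda>(a, b). fext (\<lambda>(u, v). bas (a # u, b # v)) (Dw w)) (Delta x)"

definition dw :: "'h list \<Rightarrow> ('h list \<Rightarrow> 'h list \<Rightarrow> 'k) \<Rightarrow> 'k" where
  "dw w f = kext (\<lambda>(u, v). f u v) (Dw w)"

lemma dw_Nil: "dw [] f = f [] []"
  by (simp add: dw_def kext_bas)

lemma dw_Cons: "dw (x # w) f = swf x (\<lambda>a b. dw w (\<lambda>u v. f (a # u) (b # v)))"
  by (simp add: dw_def swf_def kext_fext kext_bas case_prod_unfold)

declare Dw.simps [simp del]

lemma dw_cong: "(\<And>u v. f u v = g u v) \<Longrightarrow> dw w f = dw w g"
  by (simp add: dw_def)

lemma dw_swap: "dw w (\<lambda>a b. dw z (\<lambda>c d. f a b c d)) = dw z (\<lambda>c d. dw w (\<lambda>a b. f a b c d))"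
  by (simp add: dw_def case_prod_unfold) (rule kext_swap)

lemma dw_sw_swap: "dw w (\<lambda>a b. swf z (\<lambda>c d. f a b c d)) = swf z (\<lambda>c d. dw w (\<lambda>a b. f a b c d))"
  by (simp add: dw_def swf_def case_prod_unfold) (rule kext_swap)

lemma dw_append: "dw (w @ z) f = dw w (\<lambda>u v. dw z (\<lambda>x y. f (u @ x) (v @ y)))"
  by (induction w arbitrary: f) (simp_all add: dw_Nil dw_Cons)

lemma lin_dw_body: "(\<And>a b. lin (\<lambda>x. f x a b)) \<Longrightarrow> lin (\<lambda>x. dw w (\<lambda>a b. f x a b))"
  by (simp add: lin_def dw_def case_prod_unfold kext_plus_fun kext_times_fun)

lemma mlin_dw:
  assumes f: "\<And>v. mlin (\<lambda>u. f u v)" "\<And>u. mlin (\<lambda>v. f u v)"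
  shows "mlin (\<lambda>w. dw w (\<lambda>u v. f u v))"
  by (rule mlinI, simp only: dw_append dw_Cons)
    (intro lin_dw_body lin_intros f[THEN lin_mlin])+

lemma lin_dw_arg:
  assumes f: "\<And>v. mlin (\<lambda>u. f u v)" "\<And>u. mlin (\<lambda>v. f u v)" and "slot t"
  shows "lin (\<lambda>x. dw (t x) (\<lambda>u v. f u v))"
  by (rule lin_mlin[OF mlin_dw[OF f] assms(3)])

definition Sw :: "'h list \<Rightarrow> 'h list" where
  "Sw w = map S (rev w)"

lemma Sw_simps: "Sw [] = []" "Sw (x # w) = Sw w @ [S x]" "Sw (u @ w) = Sw w @ Sw u"
  by (simp_all add: Sw_def)

lemma mlin_Sw:
  assumes "mlin f"
  shows "mlin (\<lambda>w. f (Sw w))"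
  by (rule mlinI, simp only: Sw_simps append_assoc append_Cons append_Nil)
    (intro lin_intros lin_mlin[OF assms])

lemma slot_Sw: "slot t \<Longrightarrow> slot (\<lambda>x. Sw (t x))"
  unfolding slot_def using mlin_Sw by blast

lemmas word_lin_intros = lin_dw_body lin_dw_arg slot_Sw lin_intros

lemma dw_assoc:
  assumes "\<And>b c. mlin (\<lambda>a. f a b c)" "\<And>a c. mlin (\<lambda>b. f a b c)" "\<And>a b. mlin (\<lambda>c. f a b c)"
  shows "dw w (\<lambda>x y. dw x (\<lambda>p q. f p q y)) = dw w (\<lambda>x y. dw y (\<lambda>p q. f x p q))"
  using assms
proof (induction w arbitrary: f)
  case Nil
  then show ?case by (simp add: dw_Nil)
next
  case (Cons c w)
  note f' = Cons.prems[THEN lin_mlin]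
  have "dw (c # w) (\<lambda>x y. dw x (\<lambda>p q. f p q y))
      = swf c (\<lambda>a b. swf a (\<lambda>a1 a2. dw w (\<lambda>x y. dw x (\<lambda>p q. f (a1 # p) (a2 # q) (b # y)))))"
    by (simp only: dw_Cons dw_sw_swap)
  also have "\<dots> = swf c (\<lambda>a b. swf a (\<lambda>a1 a2. dw w (\<lambda>x y. dw y (\<lambda>p q. f (a1 # x) (a2 # p) (b # q)))))"
    by (intro sw_cong Cons.IH word_lin_intros f')
  also have "\<dots> = swf c (\<lambda>a b. swf b (\<lambda>b1 b2. dw w (\<lambda>x y. dw y (\<lambda>p q. f (a # x) (b1 # p) (b2 # q)))))"
    by (rule sw_assoc) (intro word_lin_intros f')+
  also have "\<dots> = dw (c # w) (\<lambda>x y. dw y (\<lambda>p q. f x p q))"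
    by (simp only: dw_Cons dw_sw_swap)
  finally show ?case .
qed

text \<open>The functionals satisfying \<open>par\<close> are exactly the linear forms on \<open>H\<^sub>p\<^sub>a\<^sub>r\<close>.\<close>

definition par :: "('h list \<Rightarrow> 'k) \<Rightarrow> bool" where
  "par f \<longleftrightarrow> (\<forall>g \<in> mlin_gens scale \<union> {tmul (bas u) (tmul g (bas v)) | u g v. g \<in> par_gens Delta S}.
     kext f g = 0)"

lemma kext_sw: "kext f (Defs.sw Delta h g) = swf h (\<lambda>a b. kext f (g a b))"
  by (simp add: Defs.sw_def swf_def kext_fext case_prod_unfold)

lemma sw_minus: "swf h (\<lambda>a b. f a b - g a b) = swf h f - swf h g"
  by (simp add: swf_def case_prod_unfold kext_minus_fun)

lemma mlin_iff_kext: "mlin f \<longleftrightarrow> (\<forall>g \<in> mlin_gens scale. kext f g = 0)"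
proof
  assume *: "\<forall>g \<in> mlin_gens scale. kext f g = 0"
  show "mlin f"
  proof (intro mlinI linI)
    fix u v x y c
    have "bas (u @ [x + y] @ v) - bas (u @ [x] @ v) - bas (u @ [y] @ v) \<in> mlin_gens scale"
      "bas (u @ [scale c x] @ v) - smult c (bas (u @ [x] @ v)) \<in> mlin_gens scale"
      unfolding mlin_gens_def by blast+
    with * have "kext f (bas (u @ [x + y] @ v) - bas (u @ [x] @ v) - bas (u @ [y] @ v)) = 0"
      "kext f (bas (u @ [scale c x] @ v) - smult c (bas (u @ [x] @ v))) = 0"
      by blast+
    then show "f (u @ (x + y) # v) = f (u @ x # v) + f (u @ y # v)"
      "f (u @ scale c x # v) = c * f (u @ x # v)"
      by (simp_all add: kext_diff kext_smult kext_bas) (simp add: diff_eq_eq add.commute)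
  qed
qed (simp add: kext_mlin_gens)

text \<open>The two-sided ideal appears as arbitrary surrounding words \<open>u\<close> and
  \<open>v\<close>. This form makes stability of \<open>par\<close> under translation by words
  evident.\<close>

lemma par_iff_kext:
  "par f \<longleftrightarrow> mlin f \<and> (\<forall>u v. \<forall>g \<in> par_gens Delta S. kext (\<lambda>w. f (u @ w @ v)) g = 0)"
proof -
  have "kext f (tmul (bas u) (tmul g (bas v))) = kext (\<lambda>w. f (u @ w @ v)) g" for u g v
    by (simp add: kext_tmul kext_bas)
  then show ?thesis
    unfolding par_def mlin_iff_kext ball_Un by (simp only: Ball_def mem_Collect_eq) metis
qed

text \<open>From left to right this gives rules of calculation in H_par; from right to left it is
  the checklist for the well-definedness of the comultiplication and the antipode.\<close>

lemma par_iff: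
  "par f \<longleftrightarrow> mlin f \<and> (\<forall>u v.
     f (u @ 1 # v) = f (u @ v)
   \<and> (\<forall>h k. swf k (\<lambda>a b. f (u @ h # a # S b # v)) = swf k (\<lambda>a b. f (u @ h * a # S b # v)))
   \<and> (\<forall>h k. swf k (\<lambda>a b. f (u @ h # S a # b # v)) = swf k (\<lambda>a b. f (u @ h * S a # b # v)))
   \<and> (\<forall>h k. swf h (\<lambda>a b. f (u @ a # S b # k # v)) = swf h (\<lambda>a b. f (u @ a # S b * k # v)))
   \<and> (\<forall>h k. swf h (\<lambda>a b. f (u @ S a # b # k # v)) = swf h (\<lambda>a b. f (u @ S a # b * k # v)))
   \<and> (\<forall>h. f (u @ h # v) = swf h (\<lambda>a b. swf b (\<lambda>c d. f (u @ a # S c # d # v)))))"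
proof -
  have *: "(\<forall>x\<in>{t h k | h k. True}. P x) \<longleftrightarrow> (\<forall>h k. P (t h k))"
    "(\<forall>x\<in>{r h | h. True}. P x) \<longleftrightarrow> (\<forall>h. P (r h))"
    for t :: "'h \<Rightarrow> 'h \<Rightarrow> 'h list \<Rightarrow>\<^sub>0 'k" and r :: "'h \<Rightarrow> 'h list \<Rightarrow>\<^sub>0 'k" and P
    by blast+
  have "(\<forall>u v. \<forall>g \<in> par_gens Delta S. kext (\<lambda>w. f (u @ w @ v)) g = 0) \<longleftrightarrow> (\<forall>u v.
     f (u @ 1 # v) = f (u @ v)
   \<and> (\<forall>h k. swf k (\<lambda>a b. f (u @ h # a # S b # v)) = swf k (\<lambda>a b. f (u @ h * a # S b # v)))
   \<and> (\<forall>h k. swf k (\<lambda>a b. f (u @ h # S a # b # v)) = swf k (\<lambda>a b. f (u @ h * S a # b # v)))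
   \<and> (\<forall>h k. swf h (\<lambda>a b. f (u @ a # S b # k # v)) = swf h (\<lambda>a b. f (u @ a # S b * k # v)))
   \<and> (\<forall>h k. swf h (\<lambda>a b. f (u @ S a # b # k # v)) = swf h (\<lambda>a b. f (u @ S a # b * k # v)))
   \<and> (\<forall>h. f (u @ h # v) = swf h (\<lambda>a b. swf b (\<lambda>c d. f (u @ a # S c # d # v)))))"
    unfolding par_gens_def ball_Un *
    by (simp only: ball_simps kext_diff kext_bas kext_sw sw_minus right_minus_eq
        append_assoc append_Cons append_Nil simp_thms conj_assoc)
  then show ?thesis unfolding par_iff_kext by blast
qed

section \<open>Calculation with letters in H_par\<close>

lemma par_mlin: "par f \<Longrightarrow> mlin f"
  by (simp add: par_iff)

lemma par_append_left: "par f \<Longrightarrow> par (\<lambda>w. f (u @ w))"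
  unfolding par_iff_kext using mlin_append_left[of f u] by (simp flip: append_assoc)

lemma par_append_right: "par f \<Longrightarrow> par (\<lambda>w. f (w @ v))"
  unfolding par_iff_kext using mlin_append_right[of f v] by simp

lemma par_Cons: "par f \<Longrightarrow> par (\<lambda>w. f (x # w))"
  using par_append_left[of f "[x]"] by simp

lemma par_dw: "(\<And>x y. par (\<lambda>w. f x y w)) \<Longrightarrow> par (\<lambda>w. dw z (\<lambda>x y. f x y w))"
  unfolding par_def dw_def case_prod_unfold by (subst kext_swap) (simp add: kext_def)

lemma
  assumes f: "par f"
  shows par_one: "f (1 # v) = f v"
    and par_mult1: "swf k (\<lambda>a b. f (h # a # S b # v)) = swf k (\<lambda>a b. f (h * a # S b # v))"
    and par_mult2: "swf k (\<lambda>a b. f (h # S a # b # v)) = swf k (\<lambda>a b. f (h * S a # b # v))"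
    and par_mult3: "swf h (\<lambda>a b. f (a # S b # k # v)) = swf h (\<lambda>a b. f (a # S b * k # v))"
    and par_mult4: "swf h (\<lambda>a b. f (S a # b # k # v)) = swf h (\<lambda>a b. f (S a # b * k # v))"
    and par_regular: "f (h # v) = swf h (\<lambda>a b. swf b (\<lambda>c d. f (a # S c # d # v)))"
proof -
  note * = iffD1[OF par_iff f, THEN conjunct2, rule_format, of "[]" v, unfolded append_Nil]
  note 1 = conjunct2[OF *]
  note 2 = conjunct2[OF 1]
  note 3 = conjunct2[OF 2]
  note 4 = conjunct2[OF 3]
  note 5 = conjunct2[OF 4]
  show "f (1 # v) = f v" by (rule conjunct1[OF *])
  show "swf k (\<lambda>a b. f (h # a # S b # v)) = swf k (\<lambda>a b. f (h * a # S b # v))"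
    by (rule conjunct1[OF 1, rule_format])
  show "swf k (\<lambda>a b. f (h # S a # b # v)) = swf k (\<lambda>a b. f (h * S a # b # v))"
    by (rule conjunct1[OF 2, rule_format])
  show "swf h (\<lambda>a b. f (a # S b # k # v)) = swf h (\<lambda>a b. f (a # S b * k # v))"
    by (rule conjunct1[OF 3, rule_format])
  show "swf h (\<lambda>a b. f (S a # b # k # v)) = swf h (\<lambda>a b. f (S a # b * k # v))"
    by (rule conjunct1[OF 4, rule_format])
  show "f (h # v) = swf h (\<lambda>a b. swf b (\<lambda>c d. f (a # S c # d # v)))"
    by (rule 5[rule_format])
qed

lemma par_regular':
  assumes f: "par f"
  shows "f (h # v) = swf h (\<lambda>y t. swf y (\<lambda>x s. f (x # S s # t # v)))"
  by (rule trans[OF par_regular[OF f] sw_assoc[symmetric]])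
    (intro lin_intros par_mlin[OF f, THEN lin_mlin])+

text \<open>Regularity of the letter 1 gives [1_1][S(1_2)][1_3]. The last two letters contract to
  the source element S(1_2) 1_3, which is again a leg of \<Delta>(1); \<open>sw_one_S\<close> then
  restores the antipode.\<close>

lemma sw_one_par:
  assumes f: "par f"
  shows "swf 1 (\<lambda>a b. f (a # S b # v)) = f v"
proof -
  note f' = par_mlin[OF f, THEN lin_mlin]
  have "f v = swf 1 (\<lambda>y t. swf y (\<lambda>x s. f (x # S s # t # v)))"
    by (simp only: par_regular'[OF f, symmetric] par_one[OF f])
  also have "\<dots> = swf 1 (\<lambda>y t. swf y (\<lambda>x s. f (x # S s * t # v)))"
    by (rule sw_cong, rule par_mult3[OF f])
  also have "\<dots> = swf 1 (\<lambda>x y. swf y (\<lambda>s t. f (x # S s * t # v)))"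
    by (rule sw_assoc) (intro lin_intros f')+
  also have "\<dots> = swf 1 (\<lambda>y x. swf y (\<lambda>s t. f (x # S s * t # v)))"
    by (rule sw_comm) (intro lin_intros f')+
  also have "\<dots> = swf 1 (\<lambda>p q. f (1 * q # p # v))"
    by (rule sw_source_left) (intro lin_intros f')+
  also have "\<dots> = swf 1 (\<lambda>p q. f (p # q # v))"
    by (simp only: mult_1_left, rule sw_comm) (intro lin_intros f')+
  also have "\<dots> = swf 1 (\<lambda>p q. f (p # S q # v))"
    by (rule sw_one_S[symmetric]) (intro lin_intros f')+
  finally show ?thesis by (rule sym)
qed

text \<open>Only the regularity of [h] is among the relations. Here the first two letters contract
  to a source element, which gives [1_1][S(x 1_2)] = [1_1][S(1_2) S(x)]; separating S(x) again
  leaves the trivial factor of \<open>sw_one_par\<close>.\<close>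

lemma sw_antipode_par:
  assumes f: "par f"
  shows "swf x (\<lambda>a b. swf b (\<lambda>c d. f (S a # c # S d # v))) = f (S x # v)"
proof -
  note f' = par_mlin[OF f, THEN lin_mlin]
  have "swf x (\<lambda>a b. swf b (\<lambda>c d. f (S a # c # S d # v)))
      = swf x (\<lambda>a b. swf b (\<lambda>c d. f (S a * c # S d # v)))"
    by (rule sw_cong, rule par_mult1[OF f])
  also have "\<dots> = swf x (\<lambda>p d. swf p (\<lambda>a c. f (S a * c # S d # v)))"
    by (rule sw_assoc[symmetric]) (intro lin_intros f')+
  also have "\<dots> = swf 1 (\<lambda>p q. f (p # S (x * q) # v))"
    by (rule sw_source_left) (intro lin_intros f')+
  also have "\<dots> = swf 1 (\<lambda>p q. f (p # S q # S x # v))"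
    by (simp only: S_mult, rule par_mult3[OF f, symmetric])
  also have "\<dots> = f (S x # v)"
    by (rule sw_one_par[OF f])
  finally show ?thesis .
qed

lemma sw_antipode_par':
  assumes f: "par f"
  shows "swf x (\<lambda>p d. swf p (\<lambda>a c. f (S a # c # S d # v))) = f (S x # v)"
  by (rule trans[OF sw_assoc sw_antipode_par[OF f]])
    (intro lin_intros par_mlin[OF f, THEN lin_mlin])+

text \<open>For group elements this reads [k^{-1}][k][h] = [h][(kh)^{-1}][kh]. On the right side,
  \<open>x\<close> contracts with the letter after it, and a target element of \<open>h\<close>
  appears. It becomes a leg of \<Delta>(1), which \<open>sw_one_S\<close> moves under the antipode,
  where \<Delta>(k) = \<Delta>(k)\<Delta>(1) absorbs it.\<close>

lemma source_letter:
  assumes f: "par f"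
  shows "swf k (\<lambda>a b. f (S a # b # h # v)) = swf h (\<lambda>x y. swf (k * y) (\<lambda>a b. f (x # S a # b # v)))"
proof -
  note f' = par_mlin[OF f, THEN lin_mlin]
  have "swf h (\<lambda>x y. swf (k * y) (\<lambda>a b. f (x # S a # b # v)))
      = swf h (\<lambda>x y. swf (k * y) (\<lambda>a b. f (x * S a # b # v)))"
    by (rule sw_cong, rule par_mult2[OF f])
  also have "\<dots> = swf h (\<lambda>x y. swf k (\<lambda>p q. swf y (\<lambda>r s. f (x * S (p * r) # q * s # v))))"
    by (intro sw_cong sw_mult lin_intros f')
  also have "\<dots> = swf k (\<lambda>p q. swf h (\<lambda>x y. swf y (\<lambda>r s. f (x * S r * S p # q * s # v))))"
    by (subst sw_swap) (simp only: S_mult mult.assoc)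
  also have "\<dots> = swf k (\<lambda>p q. swf h (\<lambda>y s. swf y (\<lambda>x r. f (x * S r * S p # q * s # v))))"
    by (rule sw_cong, rule sw_assoc[symmetric]) (intro lin_intros f')+
  also have "\<dots> = swf k (\<lambda>p q. swf h (\<lambda>s y. swf y (\<lambda>x r. f (x * S r * S p # q * s # v))))"
    by (rule sw_cong, rule sw_comm) (intro lin_intros f')+
  also have "\<dots> = swf k (\<lambda>p q. swf 1 (\<lambda>a b. f (b * S p # q * (a * h) # v)))"
    by (rule sw_cong, rule sw_target_right) (intro lin_intros f')+
  also have "\<dots> = swf k (\<lambda>p q. swf 1 (\<lambda>a b. f (S b * S p # q * (a * h) # v)))"
    by (rule sw_cong, rule sw_one_S[symmetric]) (intro lin_intros f')+
  also have "\<dots> = swf k (\<lambda>p q. swf 1 (\<lambda>a b. f (S (p * a) # q * b * h # v)))"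
    by (simp only: S_mult mult.assoc, rule sw_cong, rule sw_comm) (intro lin_intros f')+
  also have "\<dots> = swf (k * 1) (\<lambda>a b. f (S a # b * h # v))"
    by (rule sw_mult[symmetric]) (intro lin_intros f')+
  also have "\<dots> = swf k (\<lambda>a b. f (S a # b # h # v))"
    by (simp only: mult_1_right par_mult4[OF f])
  finally show ?thesis by (rule sym)
qed

text \<open>The counterpart for antipode letters: for group elements, [(kc)^{-1}][kc][c^{-1}] =
  [c^{-1}][k^{-1}][k]. Contracting \<open>b\<close> with \<open>S y\<close> produces a target
  element of \<open>c\<close>, whose \<Delta>(1) is absorbed by \<open>k\<close>.\<close>

lemma source_S_letter:
  assumes f: "par f"
  shows "swf c (\<lambda>x y. swf (k * x) (\<lambda>a b. f (S a # b # S y # v))) = swf k (\<lambda>a b. f (S c # S a # b # v))"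
proof -
  note f' = par_mlin[OF f, THEN lin_mlin]
  have "swf c (\<lambda>x y. swf (k * x) (\<lambda>a b. f (S a # b # S y # v)))
      = swf c (\<lambda>x y. swf (k * x) (\<lambda>a b. f (S a # b * S y # v)))"
    by (rule sw_cong, rule par_mult4[OF f])
  also have "\<dots> = swf c (\<lambda>x y. swf k (\<lambda>p q. swf x (\<lambda>r s. f (S (p * r) # q * s * S y # v))))"
    by (intro sw_cong sw_mult lin_intros f')
  also have "\<dots> = swf k (\<lambda>p q. swf c (\<lambda>x y. swf x (\<lambda>r s. f (S (p * r) # q * (s * S y) # v))))"
    by (subst sw_swap) (simp only: mult.assoc)
  also have "\<dots> = swf k (\<lambda>p q. swf c (\<lambda>r x. swf x (\<lambda>s y. f (S (p * r) # q * (s * S y) # v))))"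
    by (rule sw_cong, rule sw_assoc) (intro lin_intros f')+
  also have "\<dots> = swf k (\<lambda>p q. swf 1 (\<lambda>a b. f (S (p * (a * c)) # q * b # v)))"
    by (rule sw_cong, rule sw_target_right) (intro lin_intros f')+
  also have "\<dots> = swf k (\<lambda>p q. swf 1 (\<lambda>a b. f (S c * S (p * a) # q * b # v)))"
    by (simp only: S_mult mult.assoc)
  also have "\<dots> = swf (k * 1) (\<lambda>a b. f (S c * S a # b # v))"
    by (rule sw_mult[symmetric]) (intro lin_intros f')+
  also have "\<dots> = swf k (\<lambda>a b. f (S c # S a # b # v))"
    by (simp only: mult_1_right par_mult2[OF f])
  finally show ?thesis .
qed

text \<open>With \<open>F(k) = [S k\<^sub>1][k\<^sub>2]\<close> and \<open>E(w) = w\<^sub>1 S(w\<^sub>2)\<close>, the identities \<open>F(k)[c] = [c\<^sub>1]F(kc\<^sub>2)\<close> and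
  \<open>F(kc\<^sub>1)[S c\<^sub>2] = [S c]F(k)\<close> carry \<open>F(k)\<close> across \<open>E(cw) = [c\<^sub>1]E(w)[S c\<^sub>2]\<close>.\<close>

lemma source_letter_target_word:
  assumes "par f"
  shows "swf k (\<lambda>a b. dw w (\<lambda>u v. f (S a # b # u @ Sw v @ t)))
       = dw w (\<lambda>u v. swf k (\<lambda>a b. f (u @ Sw v @ S a # b # t)))"
  using assms
proof (induction w arbitrary: f k t)
  case Nil
  then show ?case by (simp add: dw_Nil Sw_simps)
next
  case (Cons c w)
  note f' = par_mlin[OF Cons.prems, THEN lin_mlin]
  note p1 = par_Cons[OF Cons.prems] and p2 = par_append_left[OF par_append_left[OF par_Cons[OF Cons.prems]]]
  have "swf k (\<lambda>a b. dw (c # w) (\<lambda>u v. f (S a # b # u @ Sw v @ t)))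
      = swf c (\<lambda>x y. dw w (\<lambda>u v. swf k (\<lambda>a b. f (S a # b # x # u @ Sw v @ S y # t))))"
    by (simp only: dw_Cons Sw_simps append_assoc append_Cons append_Nil dw_sw_swap sw_swap[of k])
  also have "\<dots> = swf c (\<lambda>x y. dw w (\<lambda>u v. swf x (\<lambda>x1 x2. swf (k * x2) (\<lambda>a b.
      f (x1 # S a # b # u @ Sw v @ S y # t)))))"
    by (intro sw_cong dw_cong source_letter Cons.prems)
  also have "\<dots> = swf c (\<lambda>x y. swf x (\<lambda>x1 x2. swf (k * x2) (\<lambda>a b. dw w (\<lambda>u v.
      f (x1 # S a # b # u @ Sw v @ S y # t)))))"
    by (simp only: dw_sw_swap)
  \<comment> \<open>The hypothesis is used with \<open>k * x2\<close> in place of \<open>k\<close>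
    and with \<open>f\<close> translated by \<open>x1\<close>, hence the generalization over
    both.\<close>
  also have "\<dots> = swf c (\<lambda>x y. swf x (\<lambda>x1 x2. dw w (\<lambda>u v. swf (k * x2) (\<lambda>a b.
      f (x1 # u @ Sw v @ S a # b # S y # t)))))"
    by (rule sw_cong, rule sw_cong, rule Cons.IH[OF p1])
  also have "\<dots> = swf c (\<lambda>x1 z. swf z (\<lambda>x2 y. dw w (\<lambda>u v. swf (k * x2) (\<lambda>a b.
      f (x1 # u @ Sw v @ S a # b # S y # t)))))"
    by (rule sw_assoc) (intro word_lin_intros f')+
  also have "\<dots> = swf c (\<lambda>x1 z. dw w (\<lambda>u v. swf z (\<lambda>x2 y. swf (k * x2) (\<lambda>a b.
      f (x1 # u @ Sw v @ S a # b # S y # t)))))"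
    by (rule sw_cong, rule dw_sw_swap[symmetric])
  also have "\<dots> = swf c (\<lambda>x1 z. dw w (\<lambda>u v. swf k (\<lambda>a b. f (x1 # u @ Sw v @ S z # S a # b # t))))"
    by (rule sw_cong, rule dw_cong, rule source_S_letter[OF p2])
  also have "\<dots> = dw (c # w) (\<lambda>u v. swf k (\<lambda>a b. f (u @ Sw v @ S a # b # t)))"
    by (simp only: dw_Cons Sw_simps append_assoc append_Cons append_Nil)
  finally show ?case .
qed

text \<open>By regularity [x] = [x_1] F(x_2), and F(x_2) passes E(w); what remains around E(w) is
  E(x_1 w)[x_2].\<close>

lemma letter_target_word:
  assumes f: "par f"
  shows "dw w (\<lambda>u v. f (x # u @ Sw v @ t)) = swf x (\<lambda>y z. dw (y # w) (\<lambda>u v. f (u @ Sw v @ z # t)))"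
proof -
  note f' = par_mlin[OF f, THEN lin_mlin]
  have "swf x (\<lambda>y z. dw (y # w) (\<lambda>u v. f (u @ Sw v @ z # t)))
      = swf x (\<lambda>y z. swf y (\<lambda>y1 y2. dw w (\<lambda>u v. f (y1 # u @ Sw v @ S y2 # z # t))))"
    by (simp only: dw_Cons Sw_simps append_assoc append_Cons append_Nil)
  also have "\<dots> = swf x (\<lambda>y1 z'. swf z' (\<lambda>y2 z. dw w (\<lambda>u v. f (y1 # u @ Sw v @ S y2 # z # t))))"
    by (rule sw_assoc) (intro word_lin_intros f')+
  also have "\<dots> = swf x (\<lambda>y1 z'. dw w (\<lambda>u v. swf z' (\<lambda>y2 z. f (y1 # u @ Sw v @ S y2 # z # t))))"
    by (rule sw_cong, rule dw_sw_swap[symmetric])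
  also have "\<dots> = swf x (\<lambda>y1 z'. swf z' (\<lambda>y2 z. dw w (\<lambda>u v. f (y1 # S y2 # z # u @ Sw v @ t))))"
    by (rule sw_cong, rule source_letter_target_word[OF par_Cons[OF f], symmetric])
  also have "\<dots> = dw w (\<lambda>u v. f (x # u @ Sw v @ t))"
    by (simp only: dw_sw_swap[symmetric] par_regular[OF f, symmetric])
  finally show ?thesis by (rule sym)
qed

text \<open>The outermost letters of S(q_1) q_2 belong to the last letter of \<open>q\<close>, so
  the induction removes letters at the end. The right one passes E(w) by
  \<open>letter_target_word\<close>, which lengthens the target word; the left one then meets the
  added letters and is contracted by the antipode identity.\<close>

lemma source_target_words_commute:
  assumes "par f"
  shows "dw q (\<lambda>p r. dw w (\<lambda>u v. f (Sw p @ r @ u @ Sw v @ t)))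
       = dw q (\<lambda>p r. dw w (\<lambda>u v. f (u @ Sw v @ Sw p @ r @ t)))"
  using assms
proof (induction q arbitrary: w f t rule: rev_induct)
  case Nil
  then show ?case by (simp add: dw_Nil Sw_simps)
next
  case (snoc x q)
  note f' = par_mlin[OF snoc.prems, THEN lin_mlin]
  note p1 = par_Cons[OF snoc.prems] and p2 = par_append_left[OF par_append_left[OF snoc.prems]]
    and p3 = par_append_left[OF par_append_left[OF par_Cons[OF snoc.prems]]]
  have "dw (q @ [x]) (\<lambda>p r. dw w (\<lambda>u v. f (Sw p @ r @ u @ Sw v @ t)))
      = swf x (\<lambda>x1 x2. dw q (\<lambda>p r. dw w (\<lambda>u v. f (S x1 # Sw p @ r @ x2 # u @ Sw v @ t))))"
    by (simp only: dw_append dw_Cons dw_Nil Sw_simps append_assoc append_Cons append_Nil dw_sw_swap)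
  also have "\<dots> = swf x (\<lambda>x1 x2. dw q (\<lambda>p r. swf x2 (\<lambda>y z. dw (y # w) (\<lambda>u v.
      f (S x1 # Sw p @ r @ u @ Sw v @ z # t)))))"
    by (rule sw_cong, rule dw_cong, rule letter_target_word[OF p3])
  also have "\<dots> = swf x (\<lambda>x1 x2. swf x2 (\<lambda>y z. dw q (\<lambda>p r. dw (y # w) (\<lambda>u v.
      f (S x1 # Sw p @ r @ u @ Sw v @ z # t)))))"
    by (rule sw_cong, rule dw_sw_swap)
  \<comment> \<open>The hypothesis is applied to the longer target word \<open>y # w\<close>, so
    \<open>w\<close> has to be arbitrary.\<close>
  also have "\<dots> = swf x (\<lambda>x1 x2. swf x2 (\<lambda>y z. dw q (\<lambda>p r. dw (y # w) (\<lambda>u v.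
      f (S x1 # u @ Sw v @ Sw p @ r @ z # t)))))"
    by (rule sw_cong, rule sw_cong, rule snoc.IH[OF p1])
  also have "\<dots> = swf x (\<lambda>x1 x2. swf x2 (\<lambda>y z. swf y (\<lambda>y1 y2. dw q (\<lambda>p r. dw w (\<lambda>u v.
      f (S x1 # y1 # u @ Sw v @ S y2 # Sw p @ r @ z # t))))))"
    by (simp only: dw_Cons Sw_simps append_assoc append_Cons append_Nil dw_sw_swap)
  also have "\<dots> = swf x (\<lambda>e z. swf e (\<lambda>x1 y. swf y (\<lambda>y1 y2. dw q (\<lambda>p r. dw w (\<lambda>u v.
      f (S x1 # y1 # u @ Sw v @ S y2 # Sw p @ r @ z # t))))))"
    by (rule sw_assoc[symmetric]) (intro word_lin_intros f')+
  also have "\<dots> = swf x (\<lambda>e z. swf e (\<lambda>g y2. swf g (\<lambda>x1 y1. dw q (\<lambda>p r. dw w (\<lambda>u v.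
      f (S x1 # y1 # u @ Sw v @ S y2 # Sw p @ r @ z # t))))))"
    by (rule sw_cong, rule sw_assoc[symmetric]) (intro word_lin_intros f')+
  also have "\<dots> = swf x (\<lambda>e z. swf e (\<lambda>g y2. dw q (\<lambda>p r. swf g (\<lambda>x1 y1. dw w (\<lambda>u v.
      f (S x1 # y1 # u @ Sw v @ S y2 # Sw p @ r @ z # t))))))"
    by (simp only: dw_sw_swap)
  also have "\<dots> = swf x (\<lambda>e z. swf e (\<lambda>g y2. dw q (\<lambda>p r. dw w (\<lambda>u v. swf g (\<lambda>x1 y1.
      f (u @ Sw v @ S x1 # y1 # S y2 # Sw p @ r @ z # t))))))"
    by (rule sw_cong, rule sw_cong, rule dw_cong, rule source_letter_target_word[OF snoc.prems])
  also have "\<dots> = swf x (\<lambda>e z. dw q (\<lambda>p r. dw w (\<lambda>u v. swf e (\<lambda>g y2. swf g (\<lambda>x1 y1.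
      f (u @ Sw v @ S x1 # y1 # S y2 # Sw p @ r @ z # t))))))"
    by (simp only: dw_sw_swap)
  also have "\<dots> = swf x (\<lambda>e z. dw q (\<lambda>p r. dw w (\<lambda>u v. f (u @ Sw v @ S e # Sw p @ r @ z # t))))"
    by (rule sw_cong, rule dw_cong, rule dw_cong, rule sw_antipode_par'[OF p2])
  also have "\<dots> = dw (q @ [x]) (\<lambda>p r. dw w (\<lambda>u v. f (u @ Sw v @ Sw p @ r @ t)))"
    by (simp only: dw_append dw_Cons dw_Nil Sw_simps append_assoc append_Cons append_Nil dw_sw_swap)
  finally show ?case .
qed

text \<open>Coassociativity makes the inner w_1 S(w_2) a target word, which commutes with
  [S c_2][c_3]. The word and its first letter can then be contracted independently.\<close>

lemma word_regular:
  assumes "par f"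
  shows "dw w (\<lambda>x y. dw y (\<lambda>p q. f (x @ Sw p @ q))) = f w"
  using assms
proof (induction w arbitrary: f)
  case Nil
  then show ?case by (simp add: dw_Nil Sw_simps)
next
  case (Cons c w)
  note f' = par_mlin[OF Cons.prems, THEN lin_mlin]
  have "dw (c # w) (\<lambda>x y. dw y (\<lambda>p q. f (x @ Sw p @ q)))
      = swf c (\<lambda>a b. swf b (\<lambda>b1 b2. dw w (\<lambda>u v. dw v (\<lambda>p q. f (a # u @ Sw p @ S b1 # b2 # q)))))"
    by (simp only: dw_Cons Sw_simps append_assoc append_Cons append_Nil dw_sw_swap)
  also have "\<dots> = swf c (\<lambda>a b. swf b (\<lambda>b1 b2. dw w (\<lambda>u q. dw u (\<lambda>x p. f (a # x @ Sw p @ S b1 # b2 # q)))))"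
    by (intro sw_cong, rule dw_assoc[symmetric])
      (intro word_lin_intros f')+
  also have "\<dots> = swf c (\<lambda>a b. dw w (\<lambda>u q. dw u (\<lambda>x p. swf b (\<lambda>b1 b2. f (a # x @ Sw p @ S b1 # b2 # q)))))"
    by (simp only: dw_sw_swap)
  also have "\<dots> = swf c (\<lambda>a b. dw w (\<lambda>u q. swf b (\<lambda>b1 b2. dw u (\<lambda>x p. f (a # S b1 # b2 # x @ Sw p @ q)))))"
    by (rule sw_cong, rule dw_cong, rule source_letter_target_word[OF par_Cons[OF Cons.prems], symmetric])
  also have "\<dots> = swf c (\<lambda>a b. swf b (\<lambda>b1 b2. dw w (\<lambda>u q. dw u (\<lambda>x p. f (a # S b1 # b2 # x @ Sw p @ q)))))"
    by (simp only: dw_sw_swap)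
  also have "\<dots> = swf c (\<lambda>a b. swf b (\<lambda>b1 b2. dw w (\<lambda>x y. dw y (\<lambda>p q. f (a # S b1 # b2 # x @ Sw p @ q)))))"
    by (intro sw_cong, rule dw_assoc) (intro word_lin_intros f')+
  also have "\<dots> = swf c (\<lambda>a b. swf b (\<lambda>b1 b2. f (a # S b1 # b2 # w)))"
    by (intro sw_cong Cons.IH par_Cons Cons.prems)
  also have "\<dots> = f (c # w)"
    by (rule par_regular[OF Cons.prems, symmetric])
  finally show ?case .
qed

text \<open>Moving [S c_1][c_2] past the target word w_2 S(w_3) brings it to [S c_3]. The right
  context \<open>t\<close> is arbitrary because the contracted letter joins it.\<close>

lemma word_antipode:
  assumes f: "par f"
  shows "dw w (\<lambda>x y. dw y (\<lambda>p q. f (Sw x @ p @ Sw q @ t))) = f (Sw w @ t)"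
proof (induction w arbitrary: t)
  case Nil
  then show ?case by (simp add: dw_Nil Sw_simps)
next
  case (Cons c w)
  note f' = par_mlin[OF f, THEN lin_mlin]
  note p = par_append_left[OF par_append_left[OF par_append_left[OF f]]]
  have "dw (c # w) (\<lambda>x y. dw y (\<lambda>p q. f (Sw x @ p @ Sw q @ t)))
      = dw w (\<lambda>u v. swf c (\<lambda>a b. swf b (\<lambda>b1 b2. dw v (\<lambda>p q. f (Sw u @ S a # b1 # p @ Sw q @ S b2 # t)))))"
    by (simp only: dw_Cons Sw_simps append_assoc append_Cons append_Nil dw_sw_swap)
  also have "\<dots> = dw w (\<lambda>u v. swf c (\<lambda>e b2. swf e (\<lambda>a b1. dw v (\<lambda>p q. f (Sw u @ S a # b1 # p @ Sw q @ S b2 # t)))))"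
    by (rule dw_cong, rule sw_assoc[symmetric]) (intro word_lin_intros f')+
  also have "\<dots> = dw w (\<lambda>u v. swf c (\<lambda>e b2. dw v (\<lambda>p q. swf e (\<lambda>a b1. f (Sw u @ p @ Sw q @ S a # b1 # S b2 # t)))))"
    by (rule dw_cong, rule sw_cong, rule source_letter_target_word[OF par_append_left[OF f]])
  also have "\<dots> = dw w (\<lambda>u v. dw v (\<lambda>p q. swf c (\<lambda>e b2. swf e (\<lambda>a b1. f (Sw u @ p @ Sw q @ S a # b1 # S b2 # t)))))"
    by (rule dw_cong, rule dw_sw_swap[symmetric])
  also have "\<dots> = dw w (\<lambda>u v. dw v (\<lambda>p q. f (Sw u @ p @ Sw q @ S c # t)))"
    by (rule dw_cong, rule dw_cong, rule sw_antipode_par'[OF p])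
  also have "\<dots> = f (Sw (c # w) @ t)"
    by (simp only: Cons.IH Sw_simps append_assoc append_Cons append_Nil)
  finally show ?case .
qed

subsection \<open>Well-definedness of comultiplication and antipode\<close>

text \<open>A product of two letters cannot be contracted directly, but after \<open>a\<close> is
  expanded by regularity its last leg absorbs \<open>p\<close>. Multiplication by \<open>p\<close>
  thereby takes place inside H.\<close>

lemma par_letter_mult_right:
  assumes f: "par f"
  shows "f (a # p # v) = swf a (\<lambda>y t. swf y (\<lambda>x s. f (x # S s # t * p # v)))"
proof -
  note f' = par_mlin[OF f, THEN lin_mlin]
  have "f (a # p # v) = swf a (\<lambda>x z. swf z (\<lambda>s t. f (x # S s # t # p # v)))"
    by (rule par_regular[OF f])
  also have "\<dots> = swf a (\<lambda>x z. swf z (\<lambda>s t. f (x # S s # t * p # v)))"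
    by (rule sw_cong, rule par_mult4[OF par_Cons[OF f]])
  also have "\<dots> = swf a (\<lambda>y t. swf y (\<lambda>x s. f (x # S s # t * p # v)))"
    by (rule sw_assoc[symmetric]) (intro lin_intros f')+
  finally show ?thesis .
qed

lemma par_letter_mult_left:
  assumes f: "par f"
  shows "f (p # a # v) = swf a (\<lambda>x y. swf y (\<lambda>s t. f (p * x # S s # t # v)))"
proof -
  note f' = par_mlin[OF f, THEN lin_mlin]
  have "f (p # a # v) = swf a (\<lambda>y t. swf y (\<lambda>x s. f (p # x # S s # t # v)))"
    by (rule par_regular'[OF par_Cons[OF f]])
  also have "\<dots> = swf a (\<lambda>y t. swf y (\<lambda>x s. f (p * x # S s # t # v)))"
    by (rule sw_cong, rule par_mult1[OF f])
  also have "\<dots> = swf a (\<lambda>x y. swf y (\<lambda>s t. f (p * x # S s # t # v)))"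
    by (rule sw_assoc) (intro lin_intros f')+
  finally show ?thesis .
qed

text \<open>The linear forms on H_par \<otimes> H_par; by \<open>in_J2\<close> they detect
  membership in \<open>J2 J\<close>.\<close>

definition bipar :: "('h list \<Rightarrow> 'h list \<Rightarrow> 'k) \<Rightarrow> bool" where
  "bipar f \<longleftrightarrow> (\<forall>v. par (\<lambda>u. f u v)) \<and> (\<forall>u. par (\<lambda>v. f u v))"

lemma biparD: assumes "bipar f" shows "par (\<lambda>u. f u v)" "par (\<lambda>v. f u v)"
  using assms by (auto simp: bipar_def)

lemma bipar_append_left: "bipar f \<Longrightarrow> bipar (\<lambda>x y. f (u @ x) (v @ y))"
  unfolding bipar_def by (auto intro: par_append_left par_append_left[where f = "\<lambda>w. f w _"])

lemma bipar_append_dw: "bipar f \<Longrightarrow> bipar (\<lambda>x y. dw w (\<lambda>u v. f (x @ u) (y @ v)))"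
  unfolding bipar_def
  by (auto intro!: par_dw intro: par_append_right par_append_right[where f = "\<lambda>w. f w _"])

text \<open>With \<open>par_letter_mult_right\<close> in both tensor factors, 1_1 and 1_2 multiply
  legs of \<open>c\<close> inside H. An exchange of legs makes these two legs one coproduct, and
  \<Delta>(z)\<Delta>(1) = \<Delta>(z).\<close>

lemma sw_one_right_absorb:
  assumes f: "bipar f"
  shows "swf c (\<lambda>a b. swf 1 (\<lambda>p q. f (a # p # u) (b # q # v))) = swf c (\<lambda>a b. f (a # u) (b # v))"
proof -
  note p = biparD[OF f]
  note f' = p[THEN par_mlin, THEN lin_mlin]
  \<comment> \<open>\<open>K\<close> is the form that \<open>f\<close> becomes after both letters
    are expanded; its arguments \<open>t\<close> and \<open>t'\<close> are the places where 1_1 and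
    1_2 act.\<close>
  define K where "K y t y' t' = swf y (\<lambda>x s. swf y' (\<lambda>x' s'. f (x # S s # t # u) (x' # S s' # t' # v)))"
    for y t y' t'
  have K_lin: "\<And>b c d. lin (\<lambda>a. K a b c d)" "\<And>a c d. lin (\<lambda>b. K a b c d)"
    "\<And>a b d. lin (\<lambda>c. K a b c d)" "\<And>a b c. lin (\<lambda>d. K a b c d)"
    unfolding K_def by (intro lin_intros f')+
  note K' = K_lin[THEN lin_comp]
  have K_mult: "f (a # p # u) (b # q # v) = swf a (\<lambda>y t. swf b (\<lambda>y' t'. K y (t * p) y' (t' * q)))" for a b p q
    unfolding K_def
    by (subst par_letter_mult_right[OF p(1)], subst par_letter_mult_right[OF p(2)])
      (rule sw_cong, rule sw_swap)
  have K: "f (a # u) (b # v) = swf a (\<lambda>y t. swf b (\<lambda>y' t'. K y t y' t'))" for a b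
    unfolding K_def
    by (subst par_regular'[OF p(1)], subst par_regular'[OF p(2)])
      (rule sw_cong, rule sw_swap)
  have "swf c (\<lambda>a b. swf 1 (\<lambda>p q. f (a # p # u) (b # q # v)))
      = swf c (\<lambda>a b. swf a (\<lambda>y t. swf b (\<lambda>y' t'. swf 1 (\<lambda>p q. K y (t * p) y' (t' * q)))))"
    by (simp only: K_mult sw_swap[of 1])
  also have "\<dots> = swf c (\<lambda>x z. swf x (\<lambda>y y'. swf z (\<lambda>t t'. swf 1 (\<lambda>p q. K y (t * p) y' (t' * q)))))"
    by (rule sw_exchange) (intro lin_intros K')+
  also have "\<dots> = swf c (\<lambda>x z. swf x (\<lambda>y y'. swf (z * 1) (\<lambda>t t'. K y t y' t')))"
    by (intro sw_cong sw_mult[symmetric] K_lin)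
  also have "\<dots> = swf c (\<lambda>a b. swf a (\<lambda>y t. swf b (\<lambda>y' t'. K y t y' t')))"
    by (simp only: mult_1_right, rule sw_exchange) (rule K_lin)+
  finally show ?thesis by (simp only: K)
qed

lemma sw_one_left_absorb:
  assumes f: "bipar f"
  shows "swf 1 (\<lambda>p q. swf c (\<lambda>a b. f (p # a # u) (q # b # v))) = swf c (\<lambda>a b. f (a # u) (b # v))"
proof -
  note p = biparD[OF f]
  note f' = p[THEN par_mlin, THEN lin_mlin]
  define K where "K y t y' t' = swf t (\<lambda>x s. swf t' (\<lambda>x' s'. f (y # S x # s # u) (y' # S x' # s' # v)))"
    for y t y' t'
  have K_lin: "\<And>b c d. lin (\<lambda>a. K a b c d)" "\<And>a c d. lin (\<lambda>b. K a b c d)"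
    "\<And>a b d. lin (\<lambda>c. K a b c d)" "\<And>a b c. lin (\<lambda>d. K a b c d)"
    unfolding K_def by (intro lin_intros f')+
  note K' = K_lin[THEN lin_comp]
  have K_mult: "f (p # a # u) (q # b # v) = swf a (\<lambda>y t. swf b (\<lambda>y' t'. K (p * y) t (q * y') t'))" for a b p q
    unfolding K_def
    by (subst par_letter_mult_left[OF p(1)], subst par_letter_mult_left[OF p(2)])
      (rule sw_cong, rule sw_swap)
  have K: "f (a # u) (b # v) = swf a (\<lambda>y t. swf b (\<lambda>y' t'. K y t y' t'))" for a b
    unfolding K_def
    by (subst par_regular[OF p(1)], subst par_regular[OF p(2)])
      (rule sw_cong, rule sw_swap)
  have "swf 1 (\<lambda>p q. swf c (\<lambda>a b. f (p # a # u) (q # b # v)))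
      = swf c (\<lambda>a b. swf a (\<lambda>y t. swf b (\<lambda>y' t'. swf 1 (\<lambda>p q. K (p * y) t (q * y') t'))))"
    by (simp only: K_mult sw_swap[of 1])
  also have "\<dots> = swf c (\<lambda>x z. swf x (\<lambda>y y'. swf z (\<lambda>t t'. swf 1 (\<lambda>p q. K (p * y) t (q * y') t'))))"
    by (rule sw_exchange) (intro lin_intros K')+
  also have "\<dots> = swf c (\<lambda>x z. swf 1 (\<lambda>p q. swf x (\<lambda>y y'. swf z (\<lambda>t t'. K (p * y) t (q * y') t'))))"
    by (simp only: sw_swap[of 1])
  also have "\<dots> = swf c (\<lambda>x z. swf (1 * x) (\<lambda>y y'. swf z (\<lambda>t t'. K y t y' t')))"
    by (rule sw_cong, rule sw_mult[symmetric]) (intro lin_intros K')+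
  also have "\<dots> = swf c (\<lambda>a b. swf a (\<lambda>y t. swf b (\<lambda>y' t'. K y t y' t')))"
    by (simp only: mult_1_left, rule sw_exchange) (rule K_lin)+
  finally show ?thesis by (simp only: K)
qed

text \<open>The absorbing letter is the last one of \<open>w\<close>, hence the condition that
  \<open>w\<close> is nonempty.\<close>

lemma dw_one_right_absorb:
  assumes f: "bipar f" and "w \<noteq> []"
  shows "dw (w @ 1 # z) f = dw (w @ z) f"
proof -
  obtain w' c where w: "w = w' @ [c]" using \<open>w \<noteq> []\<close> by (metis rev_exhaust)
  note p = bipar_append_dw[OF bipar_append_left[OF f], where w = z]
  have "dw (w @ 1 # z) f = dw w' (\<lambda>x y. swf c (\<lambda>a b. swf 1 (\<lambda>p q.
      dw z (\<lambda>u v. f (x @ [a, p] @ u) (y @ [b, q] @ v)))))"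
    by (simp add: w dw_append dw_Cons dw_Nil)
  also have "\<dots> = dw w' (\<lambda>x y. swf c (\<lambda>a b. dw z (\<lambda>u v. f (x @ [a] @ u) (y @ [b] @ v))))"
    by (rule dw_cong, rule sw_one_right_absorb[OF p])
  also have "\<dots> = dw (w @ z) f"
    by (simp add: w dw_append dw_Cons dw_Nil)
  finally show ?thesis .
qed

lemma dw_one_left_absorb:
  assumes f: "bipar f"
  shows "dw (1 # c # z) f = dw (c # z) f"
proof -
  note p = bipar_append_dw[OF f, where w = z]
  have "dw (1 # c # z) f = swf 1 (\<lambda>p q. swf c (\<lambda>a b. dw z (\<lambda>u v. f ([p, a] @ u) ([q, b] @ v))))"
    by (simp add: dw_Cons)
  also have "\<dots> = swf c (\<lambda>a b. dw z (\<lambda>u v. f ([a] @ u) ([b] @ v)))"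
    by (rule sw_one_left_absorb[OF p])
  also have "\<dots> = dw (c # z) f"
    by (simp add: dw_Cons)
  finally show ?thesis .
qed

text \<open>The common scheme for the four product relations, with sides \<open>s\<close> and
  \<open>s'\<close>. Comultiplying splits \<open>a\<close> and \<open>b\<close> separately; the
  exchange regroups them into pairs (a_1, b_1) and (a_2, b_2) that are each a coproduct, so the
  relation applies in one tensor factor after the other.\<close>

lemma dw_sw_relation:
  assumes f: "bipar f"
    and s: "\<And>g h a b. (\<And>v. mlin (\<lambda>u. g u v)) \<Longrightarrow> (\<And>u. mlin (\<lambda>v. g u v)) \<Longrightarrow>
      dw (s h a b) g = swf h (\<lambda>h1 h2. swf a (\<lambda>a1 a2. swf b (\<lambda>b1 b2. g (s h1 a1 b1) (s h2 a2 b2))))"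
    and s': "\<And>g h a b. (\<And>v. mlin (\<lambda>u. g u v)) \<Longrightarrow> (\<And>u. mlin (\<lambda>v. g u v)) \<Longrightarrow>
      dw (s' h a b) g = swf h (\<lambda>h1 h2. swf a (\<lambda>a1 a2. swf b (\<lambda>b1 b2. g (s' h1 a1 b1) (s' h2 a2 b2))))"
    and slots: "\<And>h b. slot (\<lambda>a. s h a b)" "\<And>h a. slot (\<lambda>b. s h a b)"
      "\<And>h b. slot (\<lambda>a. s' h a b)" "\<And>h a. slot (\<lambda>b. s' h a b)"
    and eq: "\<And>g h k. par g \<Longrightarrow> swf k (\<lambda>a b. g (s h a b)) = swf k (\<lambda>a b. g (s' h a b))"
  shows "swf k (\<lambda>a b. dw (s h a b) f) = swf k (\<lambda>a b. dw (s' h a b) f)"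
proof -
  note p = biparD[OF f]
  note m = p[THEN par_mlin]
  note f' = m[THEN lin_mlin]
  have "swf k (\<lambda>a b. dw (s h a b) f)
      = swf h (\<lambda>h1 h2. swf k (\<lambda>x y. swf x (\<lambda>a1 a2. swf y (\<lambda>b1 b2. f (s h1 a1 b1) (s h2 a2 b2)))))"
    by (simp only: s[OF m]) (rule sw_swap)
  also have "\<dots> = swf h (\<lambda>h1 h2. swf k (\<lambda>x y. swf x (\<lambda>a1 b1. swf y (\<lambda>a2 b2. f (s h1 a1 b1) (s h2 a2 b2)))))"
    by (rule sw_cong, rule sw_exchange) (intro f' slots)+
  also have "\<dots> = swf h (\<lambda>h1 h2. swf k (\<lambda>x y. swf x (\<lambda>a1 b1. swf y (\<lambda>a2 b2. f (s h1 a1 b1) (s' h2 a2 b2)))))"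
    by (rule sw_cong, rule sw_cong, rule sw_cong, rule eq[OF p(2)])
  also have "\<dots> = swf h (\<lambda>h1 h2. swf k (\<lambda>x y. swf y (\<lambda>a2 b2. swf x (\<lambda>a1 b1. f (s h1 a1 b1) (s' h2 a2 b2)))))"
    by (rule sw_cong, rule sw_cong, rule sw_swap)
  also have "\<dots> = swf h (\<lambda>h1 h2. swf k (\<lambda>x y. swf y (\<lambda>a2 b2. swf x (\<lambda>a1 b1. f (s' h1 a1 b1) (s' h2 a2 b2)))))"
    by (rule sw_cong, rule sw_cong, rule sw_cong, rule eq[OF p(1)])
  also have "\<dots> = swf h (\<lambda>h1 h2. swf k (\<lambda>x y. swf x (\<lambda>a1 b1. swf y (\<lambda>a2 b2. f (s' h1 a1 b1) (s' h2 a2 b2)))))"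
    by (rule sw_cong, rule sw_cong, rule sw_swap)
  also have "\<dots> = swf h (\<lambda>h1 h2. swf k (\<lambda>x y. swf x (\<lambda>a1 a2. swf y (\<lambda>b1 b2. f (s' h1 a1 b1) (s' h2 a2 b2)))))"
    by (rule sw_cong, rule sw_exchange) (intro f' slots)+
  also have "\<dots> = swf k (\<lambda>a b. dw (s' h a b) f)"
    by (simp only: s'[OF m]) (rule sw_swap)
  finally show ?thesis .
qed

text \<open>These formulas supply the hypotheses of \<open>dw_sw_relation\<close>: odd numbers are
  left sides of product relations, even numbers the matching right sides. They use that
  \<open>S\<close> is a coalgebra map and \<open>Delta\<close> is multiplicative.\<close>

lemma
  assumes g: "\<And>v. mlin (\<lambda>u. g u v)" "\<And>u. mlin (\<lambda>v. g u v)"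
  shows dw_S1: "dw [h, a, S b] g = swf h (\<lambda>h1 h2. swf a (\<lambda>a1 a2. swf b (\<lambda>b1 b2. g [h1, a1, S b1] [h2, a2, S b2])))"
    and dw_S2: "dw [h * a, S b] g = swf h (\<lambda>h1 h2. swf a (\<lambda>a1 a2. swf b (\<lambda>b1 b2. g [h1 * a1, S b1] [h2 * a2, S b2])))"
    and dw_S3: "dw [h, S a, b] g = swf h (\<lambda>h1 h2. swf a (\<lambda>a1 a2. swf b (\<lambda>b1 b2. g [h1, S a1, b1] [h2, S a2, b2])))"
    and dw_S4: "dw [h * S a, b] g = swf h (\<lambda>h1 h2. swf a (\<lambda>a1 a2. swf b (\<lambda>b1 b2. g [h1 * S a1, b1] [h2 * S a2, b2])))"
    and dw_S5: "dw [a, S b, h] g = swf h (\<lambda>h1 h2. swf a (\<lambda>a1 a2. swf b (\<lambda>b1 b2. g [a1, S b1, h1] [a2, S b2, h2])))"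
    and dw_S6: "dw [a, S b * h] g = swf h (\<lambda>h1 h2. swf a (\<lambda>a1 a2. swf b (\<lambda>b1 b2. g [a1, S b1 * h1] [a2, S b2 * h2])))"
    and dw_S7: "dw [S a, b, h] g = swf h (\<lambda>h1 h2. swf a (\<lambda>a1 a2. swf b (\<lambda>b1 b2. g [S a1, b1, h1] [S a2, b2, h2])))"
    and dw_S8: "dw [S a, b * h] g = swf h (\<lambda>h1 h2. swf a (\<lambda>a1 a2. swf b (\<lambda>b1 b2. g [S a1, b1 * h1] [S a2, b2 * h2])))"
proof -
  note g' = g[THEN lin_mlin]
  show "dw [h, a, S b] g = swf h (\<lambda>h1 h2. swf a (\<lambda>a1 a2. swf b (\<lambda>b1 b2. g [h1, a1, S b1] [h2, a2, S b2])))"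
    unfolding dw_Cons dw_Nil by (intro sw_cong sw_S lin_intros g')
  show "dw [h * a, S b] g = swf h (\<lambda>h1 h2. swf a (\<lambda>a1 a2. swf b (\<lambda>b1 b2. g [h1 * a1, S b1] [h2 * a2, S b2])))"
    unfolding dw_Cons dw_Nil
    by (subst sw_mult, (intro lin_intros g')+) (intro sw_cong sw_S lin_intros g')
  show "dw [h, S a, b] g = swf h (\<lambda>h1 h2. swf a (\<lambda>a1 a2. swf b (\<lambda>b1 b2. g [h1, S a1, b1] [h2, S a2, b2])))"
    unfolding dw_Cons dw_Nil by (rule sw_cong, rule sw_S) (intro lin_intros g')+
  show "dw [h * S a, b] g = swf h (\<lambda>h1 h2. swf a (\<lambda>a1 a2. swf b (\<lambda>b1 b2. g [h1 * S a1, b1] [h2 * S a2, b2])))"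
    unfolding dw_Cons dw_Nil
    by (subst sw_mult, (intro lin_intros g')+, rule sw_cong, rule sw_S) (intro lin_intros g')+
  show "dw [a, S b, h] g = swf h (\<lambda>h1 h2. swf a (\<lambda>a1 a2. swf b (\<lambda>b1 b2. g [a1, S b1, h1] [a2, S b2, h2])))"
    unfolding dw_Cons dw_Nil
    by (simp only: sw_swap[of h], rule sw_cong, rule sw_S) (intro lin_intros g')+
  show "dw [a, S b * h] g = swf h (\<lambda>h1 h2. swf a (\<lambda>a1 a2. swf b (\<lambda>b1 b2. g [a1, S b1 * h1] [a2, S b2 * h2])))"
    unfolding dw_Cons dw_Nil
    by (simp only: sw_swap[of h], rule sw_cong, subst sw_mult, (intro lin_intros g')+, rule sw_S)
      (intro lin_intros g')+
  show "dw [S a, b, h] g = swf h (\<lambda>h1 h2. swf a (\<lambda>a1 a2. swf b (\<lambda>b1 b2. g [S a1, b1, h1] [S a2, b2, h2])))"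
    unfolding dw_Cons dw_Nil
    by (simp only: sw_swap[of h], rule sw_S) (intro lin_intros g')+
  show "dw [S a, b * h] g = swf h (\<lambda>h1 h2. swf a (\<lambda>a1 a2. swf b (\<lambda>b1 b2. g [S a1, b1 * h1] [S a2, b2 * h2])))"
    unfolding dw_Cons dw_Nil
    by (simp only: sw_swap[of h], subst sw_S, (intro lin_intros g')+, intro sw_cong sw_mult lin_intros g')
qed

text \<open>Both tensor legs are expanded by regularity; two exchanges then interleave the triples
  into the coproducts of the three letters.\<close>

lemma dw_regular:
  assumes f: "bipar f"
  shows "dw [h] f = swf h (\<lambda>a b. swf b (\<lambda>c d. dw [a, S c, d] f))"
proof -
  note p = biparD[OF f]
  note f' = p[THEN par_mlin, THEN lin_mlin]
  have "dw [h] f = swf h (\<lambda>x y. swf x (\<lambda>a z. swf z (\<lambda>c d. f [a, S c, d] [y])))"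
    unfolding dw_Cons dw_Nil by (rule sw_cong, rule par_regular[OF p(1)])
  also have "\<dots> = swf h (\<lambda>x y. swf x (\<lambda>a z. swf z (\<lambda>c d. swf y (\<lambda>a' z'. swf z' (\<lambda>c' d'. f [a, S c, d] [a', S c', d'])))))"
    by (rule sw_cong, rule sw_cong, rule sw_cong, rule par_regular[OF p(2)])
  also have "\<dots> = swf h (\<lambda>x y. swf x (\<lambda>a z. swf y (\<lambda>a' z'. swf z (\<lambda>c d. swf z' (\<lambda>c' d'. f [a, S c, d] [a', S c', d'])))))"
    by (rule sw_cong, rule sw_cong, rule sw_swap)
  also have "\<dots> = swf h (\<lambda>x y. swf x (\<lambda>a a'. swf y (\<lambda>z z'. swf z (\<lambda>c d. swf z' (\<lambda>c' d'. f [a, S c, d] [a', S c', d'])))))"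
    by (rule sw_exchange) (intro lin_intros f')+
  also have "\<dots> = swf h (\<lambda>x y. swf x (\<lambda>a a'. swf y (\<lambda>z z'. swf z (\<lambda>c c'. swf z' (\<lambda>d d'. f [a, S c, d] [a', S c', d'])))))"
    by (rule sw_cong, rule sw_cong, rule sw_exchange) (intro lin_intros f')+
  also have "\<dots> = swf h (\<lambda>x y. swf y (\<lambda>z z'. swf x (\<lambda>a a'. swf z (\<lambda>c c'. swf z' (\<lambda>d d'. f [a, S c, d] [a', S c', d'])))))"
    by (rule sw_cong, rule sw_swap)
  also have "\<dots> = swf h (\<lambda>a b. swf b (\<lambda>c d. dw [a, S c, d] f))"
    by (simp only: dw_S3[OF p[THEN par_mlin]])
  finally show ?thesis .
qed

text \<open>This is the well-definedness of the comultiplication, in dual form. The leading 1 keeps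
  the word before an inserted letter 1 nonempty, which is what the relation [1] = 1
  requires.\<close>

lemma par_dw_one_Cons:
  assumes f: "bipar f"
  shows "par (\<lambda>w. dw (1 # w) f)"
  unfolding par_iff
proof (intro conjI allI)
  show "mlin (\<lambda>w. dw (1 # w) f)"
    by (intro mlin_Cons mlin_dw par_mlin biparD[OF f])
  fix u v h k
  show "dw (1 # u @ 1 # v) f = dw (1 # u @ v) f"
    using dw_one_right_absorb[OF f, of "1 # u" v] by simp
  have split: "dw (1 # u @ w @ v) f
      = dw (1 # u) (\<lambda>p q. dw w (\<lambda>x y. dw v (\<lambda>u v. f (p @ x @ u) (q @ y @ v))))" for w
    by (simp only: append_Cons[symmetric] dw_append append_assoc)
  note p = bipar_append_dw[OF bipar_append_left[OF f], where w = v, unfolded append_assoc]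
  show "swf k (\<lambda>a b. dw (1 # u @ h # a # S b # v) f) = swf k (\<lambda>a b. dw (1 # u @ h * a # S b # v) f)"
    using split[of "[h, _, S _]"] split[of "[h * _, S _]"]
    by (simp del: append_assoc add: dw_sw_swap[symmetric])
      (rule dw_cong, rule dw_sw_relation[OF p, where s = "\<lambda>h a b. [h, a, S b]" and s' = "\<lambda>h a b. [h * a, S b]"],
       simp_all add: dw_S1 dw_S2 par_mult1 slot_head slot_Cons linH_id linH_S linH_mult_left)
  show "swf k (\<lambda>a b. dw (1 # u @ h # S a # b # v) f) = swf k (\<lambda>a b. dw (1 # u @ h * S a # b # v) f)"
    using split[of "[h, S _, _]"] split[of "[h * S _, _]"]
    by (simp del: append_assoc add: dw_sw_swap[symmetric])
      (rule dw_cong, rule dw_sw_relation[OF p, where s = "\<lambda>h a b. [h, S a, b]" and s' = "\<lambda>h a b. [h * S a, b]"],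
       simp_all add: dw_S3 dw_S4 par_mult2 slot_head slot_Cons linH_id linH_S linH_mult_left)
  show "swf h (\<lambda>a b. dw (1 # u @ a # S b # k # v) f) = swf h (\<lambda>a b. dw (1 # u @ a # S b * k # v) f)"
    using split[of "[_, S _, k]"] split[of "[_, S _ * k]"]
    by (simp del: append_assoc add: dw_sw_swap[symmetric])
      (rule dw_cong, rule dw_sw_relation[OF p, where s = "\<lambda>h a b. [a, S b, h]" and s' = "\<lambda>h a b. [a, S b * h]"],
       simp_all add: dw_S5 dw_S6 par_mult3 slot_head slot_Cons linH_id linH_S linH_mult_right)
  show "swf h (\<lambda>a b. dw (1 # u @ S a # b # k # v) f) = swf h (\<lambda>a b. dw (1 # u @ S a # b * k # v) f)"
    using split[of "[S _, _, k]"] split[of "[S _, _ * k]"]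
    by (simp del: append_assoc add: dw_sw_swap[symmetric])
      (rule dw_cong, rule dw_sw_relation[OF p, where s = "\<lambda>h a b. [S a, b, h]" and s' = "\<lambda>h a b. [S a, b * h]"],
       simp_all add: dw_S7 dw_S8 par_mult4 slot_head slot_Cons linH_id linH_S linH_mult_right)
  show "dw (1 # u @ h # v) f = swf h (\<lambda>a b. swf b (\<lambda>c d. dw (1 # u @ a # S c # d # v) f))"
    using split[of "[h]"] split[of "[_, S _, _]"]
    by (simp del: append_assoc add: dw_sw_swap[symmetric])
      (rule dw_cong, rule dw_regular[OF p])
qed

text \<open>Reversal of words exchanges the first product relation with the fourth and the second
  with the third, read for \<open>S k\<close> or \<open>S h\<close>. Since \<open>S\<close> is a
  coalgebra map, the sum over \<open>k\<close> or \<open>h\<close> becomes one over its antipode,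
  and cocommutativity corrects the order of the legs.\<close>

lemma par_Sw:
  assumes f: "par f"
  shows "par (\<lambda>w. f (Sw w))"
  unfolding par_iff
proof (intro conjI allI)
  note f' = par_mlin[OF f, THEN lin_mlin]
  show "mlin (\<lambda>w. f (Sw w))" by (rule mlin_Sw[OF par_mlin[OF f]])
  fix u v h k
  note p = par_append_left[OF f, of "Sw v"]
  note norm = Sw_simps append_assoc append_Cons append_Nil S_mult
  show "f (Sw (u @ 1 # v)) = f (Sw (u @ v))"
    using par_one[OF p] by (simp add: Sw_simps S_one)
  show "swf k (\<lambda>a b. f (Sw (u @ h # a # S b # v))) = swf k (\<lambda>a b. f (Sw (u @ h * a # S b # v)))"
  proof -
    have "swf k (\<lambda>a b. f (Sw v @ S (S b) # S a # S h # Sw u)) = swf (S k) (\<lambda>a b. f (Sw v @ S b # a # S h # Sw u))"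
      by (rule sw_S[symmetric]) (intro lin_intros f')+
    also have "\<dots> = swf (S k) (\<lambda>a b. f (Sw v @ S a # b # S h # Sw u))"
      by (rule sw_comm) (intro lin_intros f')+
    also have "\<dots> = swf (S k) (\<lambda>a b. f (Sw v @ S a # b * S h # Sw u))"
      by (rule par_mult4[OF p])
    also have "\<dots> = swf (S k) (\<lambda>a b. f (Sw v @ S b # a * S h # Sw u))"
      by (rule sw_comm) (intro lin_intros f')+
    also have "\<dots> = swf k (\<lambda>a b. f (Sw v @ S (S b) # S a * S h # Sw u))"
      by (rule sw_S) (intro lin_intros f')+
    finally show ?thesis by (simp only: norm)
  qed
  show "swf k (\<lambda>a b. f (Sw (u @ h # S a # b # v))) = swf k (\<lambda>a b. f (Sw (u @ h * S a # b # v)))"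
  proof -
    have "swf k (\<lambda>a b. f (Sw v @ S b # S (S a) # S h # Sw u)) = swf (S k) (\<lambda>a b. f (Sw v @ b # S a # S h # Sw u))"
      by (rule sw_S[symmetric]) (intro lin_intros f')+
    also have "\<dots> = swf (S k) (\<lambda>a b. f (Sw v @ a # S b # S h # Sw u))"
      by (rule sw_comm) (intro lin_intros f')+
    also have "\<dots> = swf (S k) (\<lambda>a b. f (Sw v @ a # S b * S h # Sw u))"
      by (rule par_mult3[OF p])
    also have "\<dots> = swf (S k) (\<lambda>a b. f (Sw v @ b # S a * S h # Sw u))"
      by (rule sw_comm) (intro lin_intros f')+
    also have "\<dots> = swf k (\<lambda>a b. f (Sw v @ S b # S (S a) * S h # Sw u))"
      by (rule sw_S) (intro lin_intros f')+
    finally show ?thesis by (simp only: norm)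
  qed
  show "swf h (\<lambda>a b. f (Sw (u @ a # S b # k # v))) = swf h (\<lambda>a b. f (Sw (u @ a # S b * k # v)))"
  proof -
    have "swf h (\<lambda>a b. f (Sw v @ S k # S (S b) # S a # Sw u)) = swf (S h) (\<lambda>a b. f (Sw v @ S k # S b # a # Sw u))"
      by (rule sw_S[symmetric]) (intro lin_intros f')+
    also have "\<dots> = swf (S h) (\<lambda>a b. f (Sw v @ S k # S a # b # Sw u))"
      by (rule sw_comm) (intro lin_intros f')+
    also have "\<dots> = swf (S h) (\<lambda>a b. f (Sw v @ S k * S a # b # Sw u))"
      by (rule par_mult2[OF p])
    also have "\<dots> = swf (S h) (\<lambda>a b. f (Sw v @ S k * S b # a # Sw u))"
      by (rule sw_comm) (intro lin_intros f')+
    also have "\<dots> = swf h (\<lambda>a b. f (Sw v @ S k * S (S b) # S a # Sw u))"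
      by (rule sw_S) (intro lin_intros f')+
    finally show ?thesis by (simp only: norm)
  qed
  show "swf h (\<lambda>a b. f (Sw (u @ S a # b # k # v))) = swf h (\<lambda>a b. f (Sw (u @ S a # b * k # v)))"
  proof -
    have "swf h (\<lambda>a b. f (Sw v @ S k # S b # S (S a) # Sw u)) = swf (S h) (\<lambda>a b. f (Sw v @ S k # b # S a # Sw u))"
      by (rule sw_S[symmetric]) (intro lin_intros f')+
    also have "\<dots> = swf (S h) (\<lambda>a b. f (Sw v @ S k # a # S b # Sw u))"
      by (rule sw_comm) (intro lin_intros f')+
    also have "\<dots> = swf (S h) (\<lambda>a b. f (Sw v @ S k * a # S b # Sw u))"
      by (rule par_mult1[OF p])
    also have "\<dots> = swf (S h) (\<lambda>a b. f (Sw v @ S k * b # S a # Sw u))"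
      by (rule sw_comm) (intro lin_intros f')+
    also have "\<dots> = swf h (\<lambda>a b. f (Sw v @ S k * S b # S (S a) # Sw u))"
      by (rule sw_S) (intro lin_intros f')+
    finally show ?thesis by (simp only: norm)
  qed
  show "f (Sw (u @ h # v)) = swf h (\<lambda>a b. swf b (\<lambda>c d. f (Sw (u @ a # S c # d # v))))"
  proof -
    have "f (Sw v @ S h # Sw u) = swf (S h) (\<lambda>a b. swf b (\<lambda>c d. f (Sw v @ a # S c # d # Sw u)))"
      by (rule par_regular[OF p])
    also have "\<dots> = swf h (\<lambda>a b. swf (S b) (\<lambda>c d. f (Sw v @ S a # S c # d # Sw u)))"
      by (rule sw_S) (intro lin_intros f')+
    also have "\<dots> = swf h (\<lambda>a b. swf b (\<lambda>c d. f (Sw v @ S a # S (S c) # S d # Sw u)))"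
      by (rule sw_cong, rule sw_S) (intro lin_intros f')+
    also have "\<dots> = swf h (\<lambda>b a. swf b (\<lambda>c d. f (Sw v @ S a # S (S c) # S d # Sw u)))"
      by (rule sw_comm) (intro lin_intros f')+
    also have "\<dots> = swf h (\<lambda>b a. swf b (\<lambda>d c. f (Sw v @ S a # S (S c) # S d # Sw u)))"
      by (intro sw_cong sw_comm lin_intros f')
    also have "\<dots> = swf h (\<lambda>a b. swf b (\<lambda>c d. f (Sw v @ S d # S (S c) # S a # Sw u)))"
      by (rule sw_assoc) (intro lin_intros f')+
    finally show ?thesis by (simp only: norm)
  qed
qed

section \<open>The quantum inverse semigroup structure\<close>

abbreviation J :: "('h list \<Rightarrow>\<^sub>0 'k) set" where
  "J \<equiv> Hpar_rel scale Delta S"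

text \<open>The letter 1 is prepended because \<open>Delta 1\<close> need not be \<open>1 \<otimes> 1\<close>: the multiplicative extension
  of \<open>[h] \<mapsto> [h\<^sub>1] \<otimes> [h\<^sub>2]\<close> does not respect the relation \<open>[1] = 1\<close>, but the idempotent \<open>[1\<^sub>1] \<otimes> [1\<^sub>2]\<close>
  acts as a unit on the image of every nonempty word.\<close>

definition Dpar :: "('h list \<Rightarrow>\<^sub>0 'k) \<Rightarrow> ('h list \<times> 'h list \<Rightarrow>\<^sub>0 'k)" where
  "Dpar p = fext (\<lambda>w. Dw (1 # w)) p"

definition Spar :: "('h list \<Rightarrow>\<^sub>0 'k) \<Rightarrow> ('h list \<Rightarrow>\<^sub>0 'k)" where
  "Spar p = fext (\<lambda>w. bas (Sw w)) p"

lemma kext_Dw: "kext f (Dw w) = dw w (\<lambda>u v. f (u, v))"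
  by (simp add: dw_def case_prod_unfold)

lemma kext_Dpar: "kext f (Dpar p) = kext (\<lambda>w. dw (1 # w) (\<lambda>u v. f (u, v))) p"
  by (simp add: Dpar_def kext_fext kext_Dw)

lemma kext_Spar: "kext f (Spar p) = kext (\<lambda>w. f (Sw w)) p"
  by (simp add: Spar_def kext_fext kext_bas)

lemma Dpar_bas: "Dpar (bas w) = Dw (1 # w)"
  by (simp only: Dpar_def fext_bas)

lemma Spar_bas: "Spar (bas w) = bas (Sw w)"
  by (simp only: Spar_def fext_bas)

lemma dw_kext_swap: "dw w (\<lambda>x y. kext (\<lambda>z. f x y z) q) = kext (\<lambda>z. dw w (\<lambda>x y. f x y z)) q"
  by (simp add: dw_def case_prod_unfold) (rule kext_swap)

section \<open>Testing membership in the relation spaces by linear forms\<close>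

lemma kext_J: "par f \<Longrightarrow> p \<in> J \<Longrightarrow> kext f p = 0"
  unfolding Hpar_rel_def par_def by (erule kext_lspan) (erule bspec)

lemma in_J: "(\<And>f. par f \<Longrightarrow> kext f p = 0) \<Longrightarrow> p \<in> J"
  unfolding Hpar_rel_def par_def by (rule lspanI_functionals) auto

lemma parI_J:
  assumes "\<And>g. g \<in> J \<Longrightarrow> kext f g = 0"
  shows "par f"
  unfolding par_def by (rule ballI, rule assms, unfold Hpar_rel_def, erule lspan_gen)

lemma in_J2:
  assumes "\<And>f. bipar (\<lambda>u v. f (u, v)) \<Longrightarrow> kext f p = 0"
  shows "p \<in> J2 J"
  unfolding J2_def
proof (rule lspanI_functionals)
  fix f
  assume f: "\<And>g. g \<in> {otimes j (bas y) |j y. j \<in> J} \<union> {otimes (bas y) j |j y. j \<in> J} \<Longrightarrow> kext f g = 0"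
  have "kext f (otimes j (bas y)) = 0" "kext f (otimes (bas y) j) = 0" if "j \<in> J" for j y
    using f that by blast+
  then have "bipar (\<lambda>u v. f (u, v))"
    unfolding bipar_def by (auto intro!: parI_J simp: kext_otimes kext_bas)
  then show "kext f p = 0" by (rule assms)
qed

lemma in_J3:
  assumes "\<And>f. (\<And>v w. par (\<lambda>u. f (u, v, w))) \<Longrightarrow> (\<And>u w. par (\<lambda>v. f (u, v, w))) \<Longrightarrow>
    (\<And>u v. par (\<lambda>w. f (u, v, w))) \<Longrightarrow> kext f p = 0"
  shows "p \<in> J3 J"
  unfolding J3_def
proof (rule lspanI_functionals)
  fix f
  assume f: "\<And>g. g \<in> {otimes j (bas (y, z)) |j y z. j \<in> J}
              \<union> {otimes (bas y) (otimes j (bas z)) | j y z. j \<in> J}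
              \<union> {otimes (bas y) (otimes (bas z) j) | j y z. j \<in> J} \<Longrightarrow> kext f g = 0"
  have "kext f (otimes j (bas (y, z))) = 0" "kext f (otimes (bas y) (otimes j (bas z))) = 0"
    "kext f (otimes (bas y) (otimes (bas z) j)) = 0" if "j \<in> J" for j y z
    by (rule f, use that in blast)+
  then have *: "kext (\<lambda>u. f (u, y, z)) j = 0" "kext (\<lambda>u. f (y, u, z)) j = 0"
    "kext (\<lambda>u. f (y, z, u)) j = 0" if "j \<in> J" for j y z
    using that by (simp_all only: kext_otimes kext_bas)
  show "kext f p = 0"
    by (intro assms parI_J *)
qed

text \<open>Both legs of the coproduct of a nonempty word are nonempty, and this makes
  \<open>dw_one_left_absorb\<close> applicable to them.\<close>

lemma dw_Cons_cong:
  "(\<And>a b u v. f (a # u) (b # v) = g (a # u) (b # v)) \<Longrightarrow> dw (x # w) f = dw (x # w) g"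
  by (simp add: dw_Cons)

lemma unital_qisg_Hpar: "unital_qisg_on tmul (bas []) J Dpar Spar"
  unfolding unital_qisg_on_def
proof (intro conjI allI impI)
  fix p q :: "'h list \<Rightarrow>\<^sub>0 'k" and c :: 'k
  show "Dpar p - Dpar q \<in> J2 J" if "p - q \<in> J"
  proof (rule in_J2)
    fix f :: "'h list \<times> 'h list \<Rightarrow> 'k"
    assume "bipar (\<lambda>u v. f (u, v))"
    then show "kext f (Dpar p - Dpar q) = 0"
      using kext_J[OF par_dw_one_Cons that] by (simp add: kext_diff kext_Dpar)
  qed
  show "Dpar (p + q) - (Dpar p + Dpar q) \<in> J2 J"
    "Dpar (smult c p) - smult c (Dpar p) \<in> J2 J"
    by (rule in_J2; simp add: kext_diff kext_add kext_smult kext_Dpar)+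
  show "Spar p - Spar q \<in> J" if "p - q \<in> J"
    using kext_J[OF par_Sw that] by (intro in_J) (simp add: kext_diff kext_Spar)
  show "Spar (p + q) - (Spar p + Spar q) \<in> J" "Spar (smult c p) - smult c (Spar p) \<in> J"
    by (rule in_J; simp add: kext_diff kext_add kext_smult kext_Spar)+
  show "Dpar (tmul p q) - fext (\<lambda>(x, y). fext (\<lambda>(x', y').
      otimes (tmul (bas x) (bas x')) (tmul (bas y) (bas y'))) (Dpar q)) (Dpar p) \<in> J2 J"
  proof (rule in_J2)
    fix f :: "'h list \<times> 'h list \<Rightarrow> 'k"
    assume f: "bipar (\<lambda>u v. f (u, v))"
    \<comment> \<open>Each factor brings its own letter 1; that of the second factor follows the
      nonempty word \<open>1 # w\<close> and is absorbed.\<close>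
    have "dw (1 # w @ z) (\<lambda>u v. f (u, v))
        = dw (1 # w) (\<lambda>x y. dw (1 # z) (\<lambda>x' y'. f (x @ x', y @ y')))" for w z
      using dw_one_right_absorb[OF f, of "1 # w" z] dw_append[of "1 # w" "1 # z"] by simp
    then show "kext f (Dpar (tmul p q) - fext (\<lambda>(x, y). fext (\<lambda>(x', y').
        otimes (tmul (bas x) (bas x')) (tmul (bas y) (bas y'))) (Dpar q)) (Dpar p)) = 0"
      by (simp add: kext_diff kext_Dpar kext_fext kext_tmul kext_otimes kext_bas tmul_bas dw_kext_swap)
  qed
  show "fext (\<lambda>(x, y). fext (\<lambda>(x1, x2). bas (x1, x2, y)) (Dpar (bas x))) (Dpar p)
      - fext (\<lambda>(x, y). fext (\<lambda>(y1, y2). bas (x, y1, y2)) (Dpar (bas y))) (Dpar p) \<in> J3 J"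
  proof (rule in_J3)
    fix f :: "'h list \<times> 'h list \<times> 'h list \<Rightarrow> 'k"
    assume f: "\<And>v w. par (\<lambda>u. f (u, v, w))" "\<And>u w. par (\<lambda>v. f (u, v, w))" "\<And>u v. par (\<lambda>w. f (u, v, w))"
    have "dw (1 # w) (\<lambda>x y. dw (1 # x) (\<lambda>u v. f (u, v, y)))
        = dw (1 # w) (\<lambda>x y. dw (1 # y) (\<lambda>u v. f (x, u, v)))" for w
    proof -
      have "dw (1 # w) (\<lambda>x y. dw (1 # x) (\<lambda>u v. f (u, v, y))) = dw (1 # w) (\<lambda>x y. dw x (\<lambda>u v. f (u, v, y)))"
        by (intro dw_Cons_cong dw_one_left_absorb) (simp add: bipar_def f)
      also have "\<dots> = dw (1 # w) (\<lambda>x y. dw y (\<lambda>u v. f (x, u, v)))"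
        by (rule dw_assoc) (intro par_mlin f)+
      also have "\<dots> = dw (1 # w) (\<lambda>x y. dw (1 # y) (\<lambda>u v. f (x, u, v)))"
        by (intro dw_Cons_cong dw_one_left_absorb[symmetric]) (simp add: bipar_def f)
      finally show ?thesis .
    qed
    then show "kext f (fext (\<lambda>(x, y). fext (\<lambda>(x1, x2). bas (x1, x2, y)) (Dpar (bas x))) (Dpar p)
      - fext (\<lambda>(x, y). fext (\<lambda>(y1, y2). bas (x, y1, y2)) (Dpar (bas y))) (Dpar p)) = 0"
      by (simp add: kext_diff kext_fext kext_Dpar kext_bas Dpar_bas kext_Dw)
  qed
  show "Spar (tmul p q) - tmul (Spar q) (Spar p) \<in> J"
    by (rule in_J) (simp add: kext_diff kext_Spar kext_tmul Sw_simps kext_swap[of _ p q])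
  show "fext (\<lambda>(x, y). fext (\<lambda>(y1, y2). tmul (tmul (bas x) (Spar (bas y1))) (bas y2)) (Dpar (bas y))) (Dpar p) - p \<in> J"
  proof (rule in_J)
    fix f :: "'h list \<Rightarrow> 'k"
    assume f: "par f"
    have "dw (1 # w) (\<lambda>x y. dw (1 # y) (\<lambda>u v. f (x @ Sw u @ v))) = f w" for w
    proof -
      have "bipar (\<lambda>u v. f (x @ Sw u @ v))" for x
        unfolding bipar_def
        by (intro conjI allI par_append_left[OF par_append_left[OF f]]
            par_Sw[OF par_append_right[OF par_append_left[OF f]]])
      then have "dw (1 # w) (\<lambda>x y. dw (1 # y) (\<lambda>u v. f (x @ Sw u @ v))) = dw (1 # w) (\<lambda>x y. dw y (\<lambda>u v. f (x @ Sw u @ v)))"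
        by (intro dw_Cons_cong dw_one_left_absorb)
      then show ?thesis by (simp only: word_regular[OF f] par_one[OF f])
    qed
    then show "kext f (fext (\<lambda>(x, y). fext (\<lambda>(y1, y2). tmul (tmul (bas x) (Spar (bas y1))) (bas y2)) (Dpar (bas y))) (Dpar p) - p) = 0"
      by (simp add: kext_diff kext_fext kext_Dpar kext_bas Dpar_bas kext_Dw Spar_bas tmul_bas)
  qed
  show "fext (\<lambda>(x, y). fext (\<lambda>(y1, y2). tmul (tmul (Spar (bas x)) (bas y1)) (Spar (bas y2))) (Dpar (bas y))) (Dpar p)
        - Spar p \<in> J"
  proof (rule in_J)
    fix f :: "'h list \<Rightarrow> 'k"
    assume f: "par f"
    have "dw (1 # w) (\<lambda>x y. dw (1 # y) (\<lambda>u v. f (Sw x @ u @ Sw v))) = f (Sw w)" for w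
    proof -
      have "bipar (\<lambda>u v. f (Sw x @ u @ Sw v))" for x
        unfolding bipar_def
        by (intro conjI allI par_append_right[OF par_append_left[OF f]]
            par_Sw[OF par_append_left[OF par_append_left[OF f]]])
      then have "dw (1 # w) (\<lambda>x y. dw (1 # y) (\<lambda>u v. f (Sw x @ u @ Sw v))) = dw (1 # w) (\<lambda>x y. dw y (\<lambda>u v. f (Sw x @ u @ Sw v)))"
        by (intro dw_Cons_cong dw_one_left_absorb)
      \<comment> \<open>The added letter survives as the final S(1) of \<open>Sw (1 # w)\<close> and
        disappears because \<open>f\<close> composed with \<open>Sw\<close> respects [1] =
        1.\<close>
      also have "\<dots> = f (Sw (1 # w))"
        using word_antipode[OF f, of "1 # w" "[]"] by simp
      finally show ?thesis by (simp only: par_one[OF par_Sw[OF f]])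
    qed
    then show "kext f (fext (\<lambda>(x, y). fext (\<lambda>(y1, y2). tmul (tmul (Spar (bas x)) (bas y1)) (Spar (bas y2))) (Dpar (bas y))) (Dpar p)
        - Spar p) = 0"
      by (simp add: kext_diff kext_fext kext_Dpar kext_bas Dpar_bas kext_Dw Spar_bas tmul_bas kext_Spar)
  qed
  show "fext (\<lambda>(x, y). fext (\<lambda>(x', y').
              tmul (tmul (tmul (bas x) (Spar (bas y))) (Spar (bas x'))) (bas y')) (Dpar q)) (Dpar p)
         - fext (\<lambda>(x, y). fext (\<lambda>(x', y').
              tmul (tmul (tmul (Spar (bas x')) (bas y')) (bas x)) (Spar (bas y))) (Dpar q)) (Dpar p) \<in> J"
  proof (rule in_J)
    fix f :: "'h list \<Rightarrow> 'k"
    assume f: "par f"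
    have "dw (1 # w) (\<lambda>x y. dw (1 # z) (\<lambda>x' y'. f (x @ Sw y @ Sw x' @ y')))
        = dw (1 # w) (\<lambda>x y. dw (1 # z) (\<lambda>x' y'. f (Sw x' @ y' @ x @ Sw y)))" for w z
      using source_target_words_commute[OF f, of "1 # z" "1 # w" "[]"]
      by (simp add: dw_swap[of "1 # w" "1 # z"])
    then show "kext f (fext (\<lambda>(x, y). fext (\<lambda>(x', y').
              tmul (tmul (tmul (bas x) (Spar (bas y))) (Spar (bas x'))) (bas y')) (Dpar q)) (Dpar p)
         - fext (\<lambda>(x, y). fext (\<lambda>(x', y').
              tmul (tmul (tmul (Spar (bas x')) (bas y')) (bas x)) (Spar (bas y))) (Dpar q)) (Dpar p)) = 0"
      by (simp add: kext_diff kext_fext kext_Dpar kext_bas Spar_bas tmul_bas dw_kext_swap)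
  qed
  show "Spar (bas []) - bas [] \<in> J"
    by (rule in_J) (simp add: Spar_bas Sw_simps kext_zero)
qed

end

theorem theorem7p2:
  fixes scale :: "'k::field_char_0 \<Rightarrow> 'h::ring_1 \<Rightarrow> 'h"
    and Delta :: "'h \<Rightarrow> ('h \<times> 'h \<Rightarrow>\<^sub>0 'k)"
    and eps :: "'h \<Rightarrow> 'k"
    and S :: "'h \<Rightarrow> 'h"
  assumes "weak_hopf_algebra scale Delta eps S"
    and "cocommutative scale Delta"
  shows "\<exists>(D :: ('h list \<Rightarrow>\<^sub>0 'k) \<Rightarrow> ('h list \<times> 'h list \<Rightarrow>\<^sub>0 'k)) (S' :: ('h list \<Rightarrow>\<^sub>0 'k) \<Rightarrow> ('h list \<Rightarrow>\<^sub>0 'k)).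
           unital_qisg_on tmul (bas []) (Hpar_rel scale Delta S) D S'"
proof -
  interpret cocommutative_weak_hopf scale Delta eps S
    using assms by unfold_locales
  show ?thesis using unital_qisg_Hpar by blast
qed

end
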